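(* Let $L$ be an indexed language. Then there is an integer $l\ge 0$ such that for every $w\in L$ and every set of marked positions of $w$ containing at least $l$ positions, the following hold: (1) $w$ can be written as $w=u_1u_2\cdots u_n$ ($n\ge1$) and each $u_i$ as $u_i=v_{i,1}v_{i,2}\cdots v_{i,n_i}$; let $I=\{(i,j):1\le i\le n,\ 1\le j\le n_i\}$; (2) there is a map $\phi:I\to\{1,\dots,n\}$ such that, defining for all $t\ge0$: $v_{i,j}^{(0)}=v_{i,j}$, $u_i^{(t)}=v_{i,1}^{(t)}\cdots v_{i,n_i}^{(t)}$, $v_{i,j}^{(t+1)}=u_{\phi(i,j)}^{(t)}$, $w^{(t)}=u_1^{(t)}\cdots u_n^{(t)}$, we have $w^{(t)}\in L$ for all $t\ge 0$ (i.e. replacing each $v_{i,j}$ by $u_{\phi(i,j)}$ yields a word in $L$, and this can be iterated); (3) for every $(i,j)\in I$, if $v_{i,j}$ contains a marked position then so does $u_{\phi(i,j)}$; (4) there is $(\mathbf{i},\mathbf{j})\in I$ with $\phi(\mathbf{i},\mathbf{j})=\mathbf{i}$ such that $u_{\mathbf{i}}$ contains at least one marked position outside of the factor $v_{\mathbf{i},\mathbf{j}}$.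
   Context: Indexed languages are the languages generated by indexed grammars $G=(N,T,F,P,S)$: $N$, $T$, $F$ are finite alphabets of nonterminals, terminals and stack symbols, $S\in N$, and $P$ is a finite set of productions $A\to r$, $A\to Bf$, $Af\to r$ ($A,B\in N$, $f\in F$, $r\in(N\cup T)^*$). Sentential forms are strings over $NF^*\cup T$ ($Ax$ is a nonterminal with stack $x$, top first). For $r\in(N\cup T)^*$, $r\{x\}$ is $r$ with every nonterminal $A$ replaced by $Ax$. A step rewrites one occurrence $Ax$: by $A\to p$ into $p\{x\}$; by $A\to Bf$ into $Bfx$; if $x=fy$, by $Af\to p$ into $p\{y\}$. $L(G)$ is the set of terminal strings derivable from $S$ (with empty stack). The factors $u_i$, $v_{i,j}$ occupy contiguous blocks of positions of $w$ as given by the factorization; a factor "contains a marked position" if one of the positions of $w$ it occupies is marked. Factors $v_{i,j}$ may be empty. *)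

theory Defs
  imports Main
begin

datatype ('n, 't, 'f) production =
    Plain 'n "('n + 't) list"     (* A \<rightarrow> r *)
  | Push 'n 'n 'f                 (* A \<rightarrow> B f *)
  | Pop 'n 'f "('n + 't) list"    (* A f \<rightarrow> r *)

text \<open>Items of sentential forms: a nonterminal with its stack (top first), or a terminal.\<close>

datatype ('n, 't, 'f) item = NI 'n "'f list" | TI 't

definition inst :: "('n + 't) list \<Rightarrow> 'f list \<Rightarrow> ('n, 't, 'f) item list" where
  "inst r x = map (\<lambda>s. case s of Inl B \<Rightarrow> NI B x | Inr a \<Rightarrow> TI a) r"

definition step :: "('n, 't, 'f) production set \<Rightarrow> ('n, 't, 'f) item list \<Rightarrow> ('n, 't, 'f) item list \<Rightarrow> bool" where
  "step P \<alpha> \<beta> \<longleftrightarrow> (\<exists>l A x r. \<alpha> = l @ [NI A x] @ r \<and>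
     ((\<exists>p. Plain A p \<in> P \<and> \<beta> = l @ inst p x @ r) \<or>
      (\<exists>B f. Push A B f \<in> P \<and> \<beta> = l @ [NI B (f # x)] @ r) \<or>
      (\<exists>f y p. x = f # y \<and> Pop A f p \<in> P \<and> \<beta> = l @ inst p y @ r)))"

definition lang :: "('n, 't, 'f) production set \<Rightarrow> 'n \<Rightarrow> 't list set" where
  "lang P S = {w. (step P)\<^sup>*\<^sup>* [NI S []] (map TI w)}"

text \<open>A language is indexed if generated by an indexed grammar with finitely many productions.
  Finite alphabets of nonterminals and stack symbols are encoded in nat (w.l.o.g.);
  the terminals actually used are those of the finitely many productions.\<close>

definition indexed_language :: "'t list set \<Rightarrow> bool" where
  "indexed_language L \<longleftrightarrow>
     (\<exists>(P :: (nat, 't, nat) production set) S. finite P \<and> L = lang P S)"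

text \<open>A factorization is a list vs of n lists; vs!i is the list of the factors v_{i,j}
  (0-indexed) of u_i = concat (vs!i).\<close>

definition word_of :: "'t list list list \<Rightarrow> 't list" where
  "word_of vs = concat (map concat vs)"

definition u_start :: "'t list list list \<Rightarrow> nat \<Rightarrow> nat" where
  "u_start vs i = length (word_of (take i vs))"

definition u_pos :: "'t list list list \<Rightarrow> nat \<Rightarrow> nat set" where
  "u_pos vs i = {u_start vs i ..< u_start vs i + length (concat (vs ! i))}"

definition v_pos :: "'t list list list \<Rightarrow> nat \<Rightarrow> nat \<Rightarrow> nat set" where
  "v_pos vs i j = (let s = u_start vs i + length (concat (take j (vs ! i)))
                   in {s ..< s + length (vs ! i ! j)})"

fun pump :: "'t list list list \<Rightarrow> (nat \<Rightarrow> nat \<Rightarrow> nat) \<Rightarrow> nat \<Rightarrow> 't list list list" where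
  "pump vs \<phi> 0 = vs"
| "pump vs \<phi> (Suc t) =
     map (\<lambda>i. map (\<lambda>j. concat (pump vs \<phi> t ! \<phi> i j)) [0..<length (vs ! i)]) [0..<length vs]"

end

theory Submission
  imports Defs
begin

text \<open>
  Marks are carried by the letters, so that words are lists over \<open>'t \<times> bool\<close>. As for Ogden's lemma,
  a derivation of a word with many marks has a root-to-leaf path with many branching steps, that is,
  steps beside which marked letters are produced. The stack turns this path into a well-nested
  sequence of pushes and pops. If many branchings happen at one stack level, a symbol repeats there
  with the same stack and the word pumps as in a context-free grammar. Otherwise there is a long
  chain of nested stack levels with branchings between any two of them. To each level belong the
  symbol that pushes, the symbol to which the path returns when the pushed symbol is popped,
  and the set of all symbols, each with the information whether it yields a mark, to which the
  derivation returns at this level. Two levels of the chain, with stacks \<open>x\<close> and \<open>s @ x\<close>, agree in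
  these finite data. The factors \<open>u\<^sub>i\<close> are then the yields of the nodes with stack \<open>s @ x\<close>, the factors
  \<open>v\<^sub>i\<^sub>j\<close> the yields of the nodes with stack \<open>x\<close> below them, and \<open>\<phi>\<close> sends a node with stack \<open>x\<close> to a
  node with stack \<open>s @ x\<close> with the same symbol: this amounts to replacing \<open>s\<close> by a power of \<open>s\<close>.
\<close>

section \<open>Sentential forms and marked words\<close>

type_synonym ('n, 't) node = "('n + 't) \<times> ('t \<times> bool) list"
type_synonym ('n, 't, 'f) level =
  "('n + 't) \<times> 'f list \<times> ('n, 't) node list \<times> ('n, 't) node \<times> ('n, 't) node list"

definition marked :: "('t \<times> bool) list \<Rightarrow> bool" where
  "marked v \<longleftrightarrow> (\<exists>p\<in>set v. snd p)"

definition marks :: "('t \<times> bool) list \<Rightarrow> nat" where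
  "marks v = length (filter snd v)"

definition yield :: "('s \<times> 'a list) list \<Rightarrow> 'a list" where
  "yield Q = concat (map snd Q)"

definition terminals :: "('t \<times> bool) list \<Rightarrow> ('n, 't, 'f) item list" where
  "terminals v = map (\<lambda>p. TI (fst p)) v"

lemma marked_simps [simp]:
  "\<not> marked []" "marked (v @ w) \<longleftrightarrow> marked v \<or> marked w"
  by (auto simp: marked_def)

lemma marks_simps [simp]: "marks [] = 0" "marks (v @ w) = marks v + marks w"
  by (auto simp: marks_def)

lemma marked_iff_marks: "marked v \<longleftrightarrow> marks v > 0"
  by (auto simp: marked_def marks_def filter_empty_conv)

lemma yield_simps [simp]:
  "yield [] = []" "yield (p # Q) = snd p @ yield Q" "yield (Q @ Q') = yield Q @ yield Q'"
  by (auto simp: yield_def)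

lemma terminals_simps [simp]:
  "terminals [] = []" "terminals (v @ w) = terminals v @ terminals w"
  by (auto simp: terminals_def)

lemma list_all2_choice: "\<forall>p\<in>set Q. \<exists>q. R p q \<Longrightarrow> \<exists>\<rho>. list_all2 R Q \<rho>"
  by (induction Q) (auto simp: list_all2_Cons1)

lemma inst_simps [simp]:
  "inst [] x = []" "inst (r @ r') x = inst r x @ inst r' x"
  "inst [Inl A] x = [NI A x]" "inst [Inr a] x = [TI a]"
  by (auto simp: inst_def)

lemma inst_Cons: "inst (X # r) x = inst [X] x @ inst r x"
  by (auto simp: inst_def)

lemma step_context: "step P \<alpha> \<beta> \<Longrightarrow> step P (l @ \<alpha> @ r) (l @ \<beta> @ r)"
  unfolding step_def
  apply (elim exE conjE)
  subgoal for l' A x r'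
    apply (rule exI[of _ "l @ l'"], rule exI[of _ A], rule exI[of _ x], rule exI[of _ "r' @ r"])
    apply auto
    done
  done

lemma derives_context: "(step P)\<^sup>*\<^sup>* \<alpha> \<beta> \<Longrightarrow> (step P)\<^sup>*\<^sup>* (l @ \<alpha> @ r) (l @ \<beta> @ r)"
proof (induction rule: rtranclp_induct)
  case (step \<beta> \<gamma>)
  then show ?case using step_context rtranclp.rtrancl_into_rtrancl by metis
qed simp

lemma derives_append:
  assumes "(step P)\<^sup>*\<^sup>* \<alpha> \<alpha>'" "(step P)\<^sup>*\<^sup>* \<beta> \<beta>'"
  shows "(step P)\<^sup>*\<^sup>* (\<alpha> @ \<beta>) (\<alpha>' @ \<beta>')"
  using derives_context[OF assms(1), of "[]" \<beta>] derives_context[OF assms(2), of \<alpha>' "[]"]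
  by (metis append_Nil append_Nil2 rtranclp_trans)

section \<open>Derivation trees of an indexed grammar and their marked yields\<close>

locale indexed_grammar =
  fixes P :: "('n, 't, 'f) production set" and S :: 'n
  assumes finite_P: "finite P"
begin

abbreviation derives (infix "\<Rightarrow>\<^sub>G" 50) where
  "derives \<equiv> (step P)\<^sup>*\<^sup>*"

fun symbols_of :: "('n, 't, 'f) production \<Rightarrow> ('n + 't) set" where
  "symbols_of (Plain A r) = insert (Inl A) (set r)"
| "symbols_of (Push A B f) = {Inl A, Inl B}"
| "symbols_of (Pop A f r) = insert (Inl A) (set r)"

text \<open>The symbol types may be infinite; all counting takes place in this finite set.\<close>

definition V :: "('n + 't) set" where
  "V = insert (Inl S) (\<Union>(symbols_of ` P))"

lemma finite_V: "finite V"
proof -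
  have "finite (symbols_of p)" for p by (cases p) auto
  then show ?thesis using finite_P by (auto simp: V_def)
qed

lemma V_I:
  "Inl S \<in> V"
  "Plain A r \<in> P \<Longrightarrow> X \<in> insert (Inl A) (set r) \<Longrightarrow> X \<in> V"
  "Push A B f \<in> P \<Longrightarrow> X \<in> {Inl A, Inl B} \<Longrightarrow> X \<in> V"
  "Pop A f r \<in> P \<Longrightarrow> X \<in> insert (Inl A) (set r) \<Longrightarrow> X \<in> V"
  unfolding V_def by (blast, force+)

text \<open>Derivation trees replace step sequences, so that inductions run over subtrees. Passing
  the children as one list of nodes keeps right-hand side and yield aligned. A leaf accepts every
  stack and either mark.\<close>

inductive generates :: "'n + 't \<Rightarrow> 'f list \<Rightarrow> ('t \<times> bool) list \<Rightarrow> bool" where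
  gen_terminal: "generates (Inr a) x [(a, b)]"
| gen_plain: "Plain A (map fst Q) \<in> P \<Longrightarrow> \<forall>p\<in>set Q. generates (fst p) x (snd p) \<Longrightarrow>
    generates (Inl A) x (yield Q)"
| gen_push: "Push A B f \<in> P \<Longrightarrow> generates (Inl B) (f # x) v \<Longrightarrow> generates (Inl A) x v"
| gen_pop: "Pop A f (map fst Q) \<in> P \<Longrightarrow> \<forall>p\<in>set Q. generates (fst p) x (snd p) \<Longrightarrow>
    generates (Inl A) (f # x) (yield Q)"

lemma generates_Inr_iff: "generates (Inr a) x v \<longleftrightarrow> (\<exists>b. v = [(a, b)])"
  by (subst generates.simps) auto

lemma step_single:
  assumes "(\<exists>p. Plain A p \<in> P \<and> \<beta> = inst p x) \<or> (\<exists>B f. Push A B f \<in> P \<and> \<beta> = [NI B (f # x)]) \<or>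
    (\<exists>f y p. x = f # y \<and> Pop A f p \<in> P \<and> \<beta> = inst p y)"
  shows "[NI A x] \<Rightarrow>\<^sub>G \<beta>"
proof -
  have "step P ([] @ [NI A x] @ []) ([] @ \<beta> @ [])"
    unfolding step_def using assms by blast
  then show ?thesis by (simp add: r_into_rtranclp)
qed

lemma step_plain: "Plain A r \<in> P \<Longrightarrow> [NI A x] \<Rightarrow>\<^sub>G inst r x"
  by (rule step_single) blast

lemma step_push: "Push A B f \<in> P \<Longrightarrow> [NI A x] \<Rightarrow>\<^sub>G [NI B (f # x)]"
  by (rule step_single) blast

lemma step_pop: "Pop A f r \<in> P \<Longrightarrow> [NI A (f # x)] \<Rightarrow>\<^sub>G inst r x"
  by (rule step_single) blast

lemma derives_yield:
  assumes "\<forall>p\<in>set Q. inst [fst p] x \<Rightarrow>\<^sub>G terminals (snd p)"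
  shows "inst (map fst Q) x \<Rightarrow>\<^sub>G terminals (yield Q)"
  using assms
proof (induction Q)
  case (Cons p Q)
  then show ?case
    using derives_append[of P "inst [fst p] x" "terminals (snd p)" "inst (map fst Q) x"]
    by (simp add: inst_Cons[of _ "map fst Q"])
qed auto

lemma generates_sound: "generates X x v \<Longrightarrow> inst [X] x \<Rightarrow>\<^sub>G terminals v"
proof (induction rule: generates.induct)
  case (gen_terminal a x b)
  then show ?case by (simp add: terminals_def)
next
  case (gen_plain A Q x)
  then have "inst (map fst Q) x \<Rightarrow>\<^sub>G terminals (yield Q)" by (intro derives_yield) auto
  then show ?case using step_plain[OF gen_plain(1)] inst_simps(3) by (metis rtranclp_trans)
next
  case (gen_push A B f x v)
  then show ?case using step_push[OF gen_push(1)] inst_simps(3) by (metis rtranclp_trans)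
next
  case (gen_pop A f Q x)
  then have "inst (map fst Q) x \<Rightarrow>\<^sub>G terminals (yield Q)" by (intro derives_yield) auto
  then show ?case using step_pop[OF gen_pop(1)] inst_simps(3) by (metis rtranclp_trans)
qed

definition item_generates :: "('n, 't, 'f) item \<Rightarrow> ('t \<times> bool) list \<Rightarrow> bool" where
  "item_generates i v = (case i of NI A x \<Rightarrow> generates (Inl A) x v | TI a \<Rightarrow> \<exists>b. v = [(a, b)])"

lemma item_generates_inst:
  "list_all2 item_generates (inst r x) ws \<Longrightarrow>
    \<exists>Q. map fst Q = r \<and> concat ws = yield Q \<and> (\<forall>p\<in>set Q. generates (fst p) x (snd p))"
proof (induction r arbitrary: ws)
  case Nil
  then show ?case by (auto intro: exI[of _ "[]"])
next
  case (Cons X r)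
  from Cons.prems obtain i v ws' where
    *: "ws = v # ws'" "inst [X] x = [i]" "item_generates i v" "list_all2 item_generates (inst r x) ws'"
    by (cases X) (auto simp: inst_Cons[of _ r] list_all2_Cons1)
  then obtain Q where Q: "map fst Q = r" "concat ws' = yield Q"
    "\<forall>p\<in>set Q. generates (fst p) x (snd p)" using Cons.IH by blast
  have "generates X x v" using *(2,3)
    by (cases X) (auto simp: item_generates_def generates_Inr_iff)
  with * Q show ?case by (intro exI[of _ "(X, v) # Q"]) auto
qed

text \<open>Read backwards, a step merges the words of the new items into one word of the rewritten
  nonterminal; the subdivision changes, the whole word does not.\<close>

lemma generates_step:
  assumes "step P \<alpha> \<beta>" "list_all2 item_generates \<beta> ws"
  shows "\<exists>ws'. list_all2 item_generates \<alpha> ws' \<and> concat ws' = concat ws"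
proof -
  obtain l A x r \<gamma> where \<alpha>: "\<alpha> = l @ [NI A x] @ r" and \<beta>: "\<beta> = l @ \<gamma> @ r" and
    \<gamma>: "(\<exists>p. Plain A p \<in> P \<and> \<gamma> = inst p x) \<or> (\<exists>B f. Push A B f \<in> P \<and> \<gamma> = [NI B (f # x)]) \<or>
      (\<exists>f y p. x = f # y \<and> Pop A f p \<in> P \<and> \<gamma> = inst p y)"
    using assms(1) unfolding step_def by blast
  obtain w1 w2 w3 where ws: "ws = w1 @ w2 @ w3" "list_all2 item_generates l w1"
    "list_all2 item_generates \<gamma> w2" "list_all2 item_generates r w3"
    using assms(2) unfolding \<beta> by (auto simp: list_all2_append1)
  have "generates (Inl A) x (concat w2)"
    using \<gamma>
  proof (elim disjE exE conjE)
    fix p assume "Plain A p \<in> P" "\<gamma> = inst p x"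
    then show ?thesis using item_generates_inst[of p x w2] ws(3) gen_plain by metis
  next
    fix B f assume "Push A B f \<in> P" "\<gamma> = [NI B (f # x)]"
    then show ?thesis using ws(3) by (auto simp: list_all2_Cons1 item_generates_def intro: gen_push)
  next
    fix f y p assume "Pop A f p \<in> P" "\<gamma> = inst p y" "x = f # y"
    then show ?thesis using item_generates_inst[of p y w2] ws(3) gen_pop by metis
  qed
  then have "list_all2 item_generates \<alpha> (w1 @ [concat w2] @ w3)"
    unfolding \<alpha> using ws by (auto intro!: list_all2_appendI simp: item_generates_def)
  then show ?thesis using ws(1) by (intro exI[of _ "w1 @ [concat w2] @ w3"]) auto
qed

lemma generates_complete:
  assumes "\<alpha> \<Rightarrow>\<^sub>G terminals w"
  shows "\<exists>ws. list_all2 item_generates \<alpha> ws \<and> concat ws = w"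
  using assms
proof (induction rule: converse_rtranclp_induct)
  case base
  have "list_all2 item_generates (terminals w) (map (\<lambda>p. [p]) w)"
    by (induction w) (auto simp: terminals_def item_generates_def)
  moreover have "concat (map (\<lambda>p. [p]) w) = w" by (induction w) auto
  ultimately show ?case by blast
next
  case (step \<alpha> \<beta>)
  then show ?case using generates_step by metis
qed

text \<open>The marks of \<open>w\<close> are arbitrary because the leaves of
  \<open>generates\<close> leave them free.\<close>

lemma lang_generates: "map fst w \<in> lang P S \<longleftrightarrow> generates (Inl S) [] w"
proof
  assume "map fst w \<in> lang P S"
  then have "[NI S []] \<Rightarrow>\<^sub>G terminals w" by (simp add: lang_def terminals_def comp_def)
  then show "generates (Inl S) [] w" using generates_complete[of "[NI S []]" w]
    by (auto simp: list_all2_Cons1 item_generates_def)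
next
  assume "generates (Inl S) [] w"
  then show "map fst w \<in> lang P S"
    using generates_sound[of "Inl S" "[]" w] by (simp add: lang_def terminals_def comp_def)
qed

section \<open>Cutting a derivation where a stack prefix has been popped\<close>

text \<open>The quantifier over \<open>x\<close> is what permits pumping: the consumption of
  \<open>s\<close> can be repeated above the longer stacks of the pumped derivation.\<close>

definition consumes :: "'f list \<Rightarrow> ('n + 't) list \<Rightarrow> ('n + 't) list \<Rightarrow> bool" where
  "consumes s r r' \<longleftrightarrow> (\<forall>x. inst r (s @ x) \<Rightarrow>\<^sub>G inst r' x)"

lemma consumes_refl: "consumes [] r r"
  by (simp add: consumes_def)

lemma consumes_trans: "consumes s r r' \<Longrightarrow> consumes s' r' r'' \<Longrightarrow> consumes (s @ s') r r''"
  unfolding consumes_def by (metis append_assoc rtranclp_trans)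

lemma consumes_append:
  "consumes s r1 r1' \<Longrightarrow> consumes s r2 r2' \<Longrightarrow> consumes s (r1 @ r2) (r1' @ r2')"
  by (simp add: consumes_def derives_append)

definition wf_at :: "'f list \<Rightarrow> ('n, 't) node list \<Rightarrow> bool" where
  "wf_at x Q \<longleftrightarrow> (\<forall>p\<in>set Q. fst p \<in> V \<and> generates (fst p) x (snd p))"

lemma wf_at_simps [simp]:
  "wf_at x []" "wf_at x (Q @ Q') \<longleftrightarrow> wf_at x Q \<and> wf_at x Q'"
  "wf_at x (p # Q) \<longleftrightarrow> (fst p \<in> V \<and> generates (fst p) x (snd p)) \<and> wf_at x Q"
  by (auto simp: wf_at_def)

lemma wf_at_derives: "wf_at x Q \<Longrightarrow> inst (map fst Q) x \<Rightarrow>\<^sub>G terminals (yield Q)"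
  by (intro derives_yield) (auto simp: wf_at_def intro: generates_sound)

text \<open>\<open>Q\<close> lists the nodes below the node \<open>p\<close> (with stack \<open>s @ x\<close>) at which \<open>s\<close> has just been popped.
  Terminals count as nodes with any stack.\<close>

definition frontier :: "'f list \<Rightarrow> 'f list \<Rightarrow> ('n, 't) node \<Rightarrow> ('n, 't) node list \<Rightarrow> bool" where
  "frontier s x p Q \<longleftrightarrow> wf_at x Q \<and> snd p = yield Q \<and> consumes s [fst p] (map fst Q)"

lemma cut_refl: "wf_at x [p] \<Longrightarrow> frontier [] x p [p]"
  by (simp add: frontier_def consumes_refl)

lemma cuts_concat:
  assumes "list_all2 (frontier s x) Q \<rho>"
  shows "wf_at x (concat \<rho>)" "yield (concat \<rho>) = yield Q"
    "consumes s (map fst Q) (map fst (concat \<rho>))"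
proof -
  have "wf_at x (concat \<rho>) \<and> yield (concat \<rho>) = yield Q \<and>
    consumes s (map fst Q) (map fst (concat \<rho>))"
    using assms
  proof (induction rule: list_all2_induct)
    case Nil
    then show ?case by (simp add: consumes_def)
  next
    case (Cons p Q q \<rho>)
    then show ?case
      using consumes_append[of s "[fst p]" "map fst q"] by (auto simp: frontier_def)
  qed
  then show "wf_at x (concat \<rho>)" "yield (concat \<rho>) = yield Q"
    "consumes s (map fst Q) (map fst (concat \<rho>))" by auto
qed

lemma cut_trans:
  assumes "frontier s (s' @ x) p Q" "list_all2 (frontier s' x) Q \<rho>"
  shows "frontier (s @ s') x p (concat \<rho>)"
  using assms(1) cuts_concat[OF assms(2)] unfolding frontier_def by (auto intro: consumes_trans)

lemma cuts_trans:
  assumes "list_all2 (frontier s (s' @ x)) Q \<rho>" "list_all2 (frontier s' x) (concat \<rho>) \<sigma>"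
  shows "\<exists>\<tau>. list_all2 (frontier (s @ s') x) Q \<tau> \<and> concat \<tau> = concat \<sigma>"
  using assms
proof (induction arbitrary: \<sigma> rule: list_all2_induct)
  case Nil
  then show ?case by auto
next
  case (Cons p Q q \<rho>)
  from Cons.prems obtain \<sigma>1 \<sigma>2 where \<sigma>: "\<sigma> = \<sigma>1 @ \<sigma>2" "list_all2 (frontier s' x) q \<sigma>1"
    "list_all2 (frontier s' x) (concat \<rho>) \<sigma>2" by (auto simp: list_all2_append1)
  obtain \<tau> where "list_all2 (frontier (s @ s') x) Q \<tau>" "concat \<tau> = concat \<sigma>2"
    using Cons.IH \<sigma>(3) by blast
  then show ?case using cut_trans[OF Cons.hyps(1) \<sigma>(2)] \<sigma>(1)
    by (intro exI[of _ "concat \<sigma>1 # \<tau>"]) auto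
qed

text \<open>Every branch pops all of \<open>s\<close> or ends in a terminal before that, and is cut
  there. The induction generalises over \<open>s\<close> because pushes lengthen and pops shorten
  it.\<close>

lemma cut_exists:
  "generates X (s @ x) v \<Longrightarrow> X \<in> V \<Longrightarrow> \<exists>Q. frontier s x (X, v) Q"
proof (induction X "s @ x" v arbitrary: s rule: generates.induct)
  case (gen_terminal a b)
  then have "frontier s x (Inr a, [(a, b)]) [(Inr a, [(a, b)])]"
    by (auto simp: frontier_def consumes_def generates_Inr_iff)
  then show ?case by blast
next
  case (gen_plain A Q)
  have "fst p \<in> V" if "p \<in> set Q" for p using that V_I(2)[OF gen_plain(1)] by auto
  then have "\<forall>p\<in>set Q. \<exists>q. frontier s x p q" using gen_plain(2) by auto
  then obtain \<rho> where \<rho>: "list_all2 (frontier s x) Q \<rho>"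
    using list_all2_choice by blast
  have "consumes [] [Inl A] (map fst Q)" using step_plain[OF gen_plain(1)] by (simp add: consumes_def)
  then have "frontier s x (Inl A, yield Q) (concat \<rho>)"
    using cuts_concat[OF \<rho>] consumes_trans[of "[]"] by (auto simp: frontier_def)
  then show ?case by blast
next
  case (gen_push A B f v)
  obtain Q where Q: "frontier (f # s) x (Inl B, v) Q"
    using gen_push.hyps(3)[of "f # s"] V_I(3)[OF gen_push.hyps(1)] by auto
  then have "[NI B (f # s @ y)] \<Rightarrow>\<^sub>G inst (map fst Q) y" for y
    by (simp add: frontier_def consumes_def)
  then have "consumes s [Inl A] (map fst Q)"
    unfolding consumes_def inst_simps(3)
    using step_push[OF gen_push.hyps(1)] by (meson rtranclp_trans)
  then show ?case using Q by (auto simp: frontier_def)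
next
  case (gen_pop A f Q y)
  show ?case
  proof (cases s)
    case Nil
    have "generates (Inl A) (f # y) (yield Q)" using gen_pop generates.gen_pop by blast
    then show ?thesis using Nil gen_pop cut_refl[of x "(Inl A, yield Q)"] by auto
  next
    case (Cons g s')
    then have y: "y = s' @ x" "g = f" using gen_pop by auto
    have "fst p \<in> V" if "p \<in> set Q" for p using that V_I(4)[OF gen_pop(1)] by auto
    then have "\<forall>p\<in>set Q. \<exists>q. frontier s' x p q" using gen_pop(2) y by auto
    then obtain \<rho> where \<rho>: "list_all2 (frontier s' x) Q \<rho>"
      using list_all2_choice by blast
    have "consumes [f] [Inl A] (map fst Q)" using step_pop[OF gen_pop(1)] by (simp add: consumes_def)
    then have "frontier s x (Inl A, yield Q) (concat \<rho>)"
      using cuts_concat[OF \<rho>] consumes_trans[of "[f]"] y Cons by (auto simp: frontier_def)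
    then show ?thesis by blast
  qed
qed

lemma cuts_exist:
  "wf_at (s @ x) Q \<Longrightarrow> \<exists>\<rho>. list_all2 (frontier s x) Q \<rho>"
proof (induction Q)
  case (Cons p Q)
  then obtain q \<rho> where "frontier s x p q" "list_all2 (frontier s x) Q \<rho>"
    using cut_exists[of "fst p" s x "snd p"] by auto
  then show ?case by (intro exI[of _ "q # \<rho>"]) auto
qed auto

text \<open>Continues a path from \<open>q\<close> to \<open>q'\<close> and cuts the side nodes at
  \<open>x\<close> as well. Cuts preserve yields, so no mark beside the path is lost.\<close>

lemma cut_refine:
  assumes "frontier [] (s @ x) p (L @ q # R)" "frontier s x q (L' @ q' # R')"
  shows "\<exists>L'' R''. frontier s x p ((L'' @ L') @ q' # (R' @ R'')) \<and> yield L'' = yield L \<and> yield R'' = yield R"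
proof -
  have "wf_at (s @ x) L" "wf_at (s @ x) R" using assms(1) by (auto simp: frontier_def)
  then obtain \<rho> \<sigma> where *: "list_all2 (frontier s x) L \<rho>" "list_all2 (frontier s x) R \<sigma>"
    using cuts_exist by meson
  then have "list_all2 (frontier s x) (L @ q # R) (\<rho> @ (L' @ q' # R') # \<sigma>)"
    using assms(2) by (auto intro!: list_all2_appendI)
  from cut_trans[OF assms(1) this] cuts_concat(2)[OF *(1)] cuts_concat(2)[OF *(2)]
  show ?thesis by (intro exI[of _ "concat \<rho>"] exI[of _ "concat \<sigma>"]) auto
qed

section \<open>Excursions and segments\<close>

definition pushes :: "'n + 't \<Rightarrow> 'f \<Rightarrow> 'n + 't \<Rightarrow> bool" where
  "pushes X f Y \<longleftrightarrow> (\<forall>x. inst [X] x \<Rightarrow>\<^sub>G inst [Y] (f # x))"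

lemma frontier_push:
  assumes "pushes (fst p) f (fst p')" "snd p' = snd p" "frontier (f # s) x p' Q"
  shows "frontier s x p Q"
proof -
  have "inst [fst p] (s @ y) \<Rightarrow>\<^sub>G inst (map fst Q) y" for y
  proof -
    have "inst [fst p'] (f # s @ y) \<Rightarrow>\<^sub>G inst (map fst Q) y"
      using assms(3) by (simp add: frontier_def consumes_def)
    then show ?thesis using assms(1) unfolding pushes_def by (meson rtranclp_trans)
  qed
  then show ?thesis using assms(2,3) by (simp add: frontier_def consumes_def)
qed

text \<open>A segment is a part of a path that starts and ends at the same stack \<open>x\<close> and never pops
  below it; it is composed of excursions, each a plain step or a push together with its matching pop.
  The number counts the branching steps.\<close>

inductive excursion :: "'f list \<Rightarrow> ('n, 't) node \<Rightarrow> nat \<Rightarrow> ('n, 't) node \<Rightarrow> bool"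
  and segment :: "'f list \<Rightarrow> ('n, 't) node \<Rightarrow> nat \<Rightarrow> ('n, 't) node \<Rightarrow> bool" where
  exc_plain: "wf_at x [p] \<Longrightarrow> frontier [] x p (L @ q # R) \<Longrightarrow>
    excursion x p (of_bool (marked (yield (L @ R)))) q"
| exc_push: "wf_at x [p] \<Longrightarrow> pushes (fst p) f (fst p') \<Longrightarrow> snd p' = snd p \<Longrightarrow>
    segment (f # x) p' n q' \<Longrightarrow> frontier [f] x q' (L @ q # R) \<Longrightarrow>
    excursion x p (n + of_bool (marked (yield (L @ R)))) q"
| seg_refl: "wf_at x [p] \<Longrightarrow> segment x p 0 p"
| seg_step: "excursion x p m q \<Longrightarrow> segment x q n r \<Longrightarrow> segment x p (m + n) r"

text \<open>Of the path only its end and its side branches are kept; together they form a frontier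
  of \<open>p\<close> for the unchanged stack. Of the count only positivity survives, as a mark
  beside \<open>q\<close>.\<close>

lemma excursion_segment_frontier:
  "excursion x p m q \<Longrightarrow> wf_at x [p] \<and>
    (\<exists>L R. frontier [] x p (L @ q # R) \<and> (m > 0 \<longrightarrow> marked (yield (L @ R))))"
  "segment x p m q \<Longrightarrow> wf_at x [p] \<and>
    (\<exists>L R. frontier [] x p (L @ q # R) \<and> (m > 0 \<longrightarrow> marked (yield (L @ R))))"
proof (induct rule: excursion_segment.inducts)
  case (exc_plain x p L q R)
  then show ?case by (intro conjI exI[of _ L] exI[of _ R]) auto
next
  case (exc_push x p f p' n q' L q R)
  then obtain L0 R0 where *: "frontier [] (f # x) p' (L0 @ q' # R0)"
    "n > 0 \<longrightarrow> marked (yield (L0 @ R0))" by blast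
  obtain L' R' where **: "frontier [f] x p' ((L' @ L) @ q # (R @ R'))" "yield L' = yield L0"
    "yield R' = yield R0"
    using cut_refine[of "[f]" x p' L0 q' R0 L q R] * exc_push.hyps by auto
  then have "frontier [] x p ((L' @ L) @ q # (R @ R'))"
    using exc_push.hyps frontier_push by blast
  moreover have "n + of_bool (marked (yield (L @ R))) > 0 \<longrightarrow> marked (yield ((L' @ L) @ (R @ R')))"
    using * ** by auto
  ultimately show ?case using exc_push.hyps(1)
    by (intro conjI exI[of _ "L' @ L"] exI[of _ "R @ R'"])
next
  case (seg_refl x p)
  then show ?case using cut_refl by (intro conjI exI[of _ "[]"]) auto
next
  case (seg_step x p m q n r)
  then obtain L R L' R' where *: "frontier [] x p (L @ q # R)" "m > 0 \<longrightarrow> marked (yield (L @ R))"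
    "frontier [] x q (L' @ r # R')" "n > 0 \<longrightarrow> marked (yield (L' @ R'))" by blast
  then obtain L'' R'' where "frontier [] x p ((L'' @ L') @ r # (R' @ R''))" "yield L'' = yield L"
    "yield R'' = yield R"
    using cut_refine[of "[]" x p L q R L' r R'] by auto
  then show ?case using * seg_step.hyps
    by (intro conjI exI[of _ "L'' @ L'"] exI[of _ "R' @ R''"]) auto
qed

section \<open>Context-free pumping at a repeated symbol\<close>

text \<open>\<open>Y\<close> derives itself between \<open>a\<close> and \<open>b\<close> at one
  fixed stack. This stack \<open>y\<close> may differ from \<open>x\<close>, since the repetition
  may occur inside a push.\<close>

definition cf_pumpable :: "'f list \<Rightarrow> ('n, 't) node \<Rightarrow> bool" where
  "cf_pumpable x p \<longleftrightarrow> (\<exists>l Y y a m b r. snd p = l @ a @ m @ b @ r \<and>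
    inst [fst p] x \<Rightarrow>\<^sub>G terminals l @ inst [Y] y @ terminals r \<and>
    inst [Y] y \<Rightarrow>\<^sub>G terminals a @ inst [Y] y @ terminals b \<and>
    inst [Y] y \<Rightarrow>\<^sub>G terminals m \<and> marked (a @ b))"

lemma frontier_derives:
  assumes "frontier s x p (L @ q # R)"
  shows "inst [fst p] (s @ x) \<Rightarrow>\<^sub>G terminals (yield L) @ inst [fst q] x @ terminals (yield R)"
proof -
  have "inst [fst p] (s @ x) \<Rightarrow>\<^sub>G inst (map fst L) x @ inst [fst q] x @ inst (map fst R) x"
    using assms by (simp add: frontier_def consumes_def inst_Cons[of _ "map fst R"])
  moreover have "inst (map fst L) x @ inst [fst q] x @ inst (map fst R) x
    \<Rightarrow>\<^sub>G terminals (yield L) @ inst [fst q] x @ terminals (yield R)"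
    using assms by (intro derives_append wf_at_derives) (auto simp: frontier_def)
  ultimately show ?thesis by (rule rtranclp_trans)
qed

lemma cf_pumpable_frontier:
  assumes "frontier [] x p (L @ q # R)" "cf_pumpable x q"
  shows "cf_pumpable x p"
proof -
  obtain l Y y a m b r where *: "snd q = l @ a @ m @ b @ r"
    "inst [fst q] x \<Rightarrow>\<^sub>G terminals l @ inst [Y] y @ terminals r"
    "inst [Y] y \<Rightarrow>\<^sub>G terminals a @ inst [Y] y @ terminals b"
    "inst [Y] y \<Rightarrow>\<^sub>G terminals m" "marked (a @ b)"
    using assms(2) unfolding cf_pumpable_def by blast
  have "inst [fst p] x \<Rightarrow>\<^sub>G terminals (yield L) @ inst [fst q] x @ terminals (yield R)"
    using frontier_derives[OF assms(1)] by simp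
  then have "inst [fst p] x \<Rightarrow>\<^sub>G terminals (yield L @ l) @ inst [Y] y @ terminals (r @ yield R)"
    using derives_context[OF *(2), of "terminals (yield L)" "terminals (yield R)"]
    by (simp add: rtranclp_trans)
  moreover have "snd p = (yield L @ l) @ a @ m @ b @ (r @ yield R)"
    using assms(1) *(1) by (simp add: frontier_def)
  ultimately show ?thesis using *(3-5) unfolding cf_pumpable_def by blast
qed

lemma cf_pumpable_push:
  assumes "pushes (fst p) f (fst p')" "snd p' = snd p" "cf_pumpable (f # x) p'"
  shows "cf_pumpable x p"
proof -
  obtain l Y y a m b r where *: "snd p' = l @ a @ m @ b @ r"
    "inst [fst p'] (f # x) \<Rightarrow>\<^sub>G terminals l @ inst [Y] y @ terminals r"
    "inst [Y] y \<Rightarrow>\<^sub>G terminals a @ inst [Y] y @ terminals b"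
    "inst [Y] y \<Rightarrow>\<^sub>G terminals m" "marked (a @ b)"
    using assms(3) unfolding cf_pumpable_def by blast
  moreover have "inst [fst p] x \<Rightarrow>\<^sub>G terminals l @ inst [Y] y @ terminals r"
    using assms(1) *(2) unfolding pushes_def by (meson rtranclp_trans)
  ultimately show ?thesis using assms(2) unfolding cf_pumpable_def by metis
qed

text \<open>The segment returns to its initial symbol and stack, so it can be iterated; a branching
  puts a mark into the repeated part.\<close>

lemma cf_pumpable_segment:
  assumes "segment x p n (fst p, u)" "n > 0"
  shows "cf_pumpable x p"
proof -
  obtain L R where *: "frontier [] x p (L @ (fst p, u) # R)" "marked (yield (L @ R))"
    using excursion_segment_frontier(2)[OF assms(1)] assms(2) by blast
  then have "inst [fst p] x \<Rightarrow>\<^sub>G terminals (yield L) @ inst [fst p] x @ terminals (yield R)"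
    using frontier_derives by fastforce
  moreover have "inst [fst p] x \<Rightarrow>\<^sub>G terminals u"
    using *(1) generates_sound by (simp add: frontier_def)
  moreover have "snd p = [] @ yield L @ u @ yield R @ []" using *(1) by (simp add: frontier_def)
  moreover have "inst [fst p] x \<Rightarrow>\<^sub>G terminals [] @ inst [fst p] x @ terminals []" by simp
  moreover have "marked (yield L @ yield R)" using *(2) by simp
  ultimately show ?thesis unfolding cf_pumpable_def by blast
qed

text \<open>\<open>Z\<close> collects the symbols at which branching excursions start. If none of these has more than
  \<open>M\<close> branchings and \<open>n > M * card V\<close>, then a symbol repeats and gives a context-free pump.\<close>

definition decomposable where
  "decomposable T M x p n q \<longleftrightarrow> cf_pumpable x p \<or>
    (\<exists>n0 p1 m p2 n2. M < m \<and> segment x p n0 p1 \<and> T x p1 m p2 \<and> excursion x p1 m p2 \<and>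
      segment x p2 n2 q \<and> n = n0 + m + n2) \<or>
    (\<exists>Z\<subseteq>V. n \<le> M * card Z \<and>
      (\<forall>z\<in>Z. \<exists>u k m. segment x p k (z, u) \<and> segment x (z, u) m q \<and> m > 0))"

text \<open>Unless the rest already settles the matter, an excursion with more than \<open>M\<close>
  branchings is itself the large one, and one without branchings leaves \<open>Z\<close> as it is.
  Otherwise \<open>fst p\<close> lies in \<open>Z\<close>, which closes a loop with a branching, or
  enlarges \<open>Z\<close> by one element, which accounts for at most \<open>M\<close> branchings.
  \<open>T\<close> carries what a surrounding induction knows about excursions.\<close>

lemma decomposable_step:
  assumes e: "excursion x p m q" "T x p m q" "segment x q n r" and d: "decomposable T M x q n r"
  shows "decomposable T M x p (m + n) r"
proof -
  obtain L R where LR: "frontier [] x p (L @ q # R)" and wf: "wf_at x [p]"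
    using excursion_segment_frontier(1)[OF e(1)] by blast
  consider "cf_pumpable x q"
    | n0 p1 m' p2 n2 where "M < m'" "segment x q n0 p1" "T x p1 m' p2" "excursion x p1 m' p2"
      "segment x p2 n2 r" "n = n0 + m' + n2"
    | "M < m"
    | Z where "m \<le> M" "Z \<subseteq> V" "n \<le> M * card Z"
      "\<forall>z\<in>Z. \<exists>u k m. segment x q k (z, u) \<and> segment x (z, u) m r \<and> m > 0"
    using d unfolding decomposable_def by force
  then show ?thesis
  proof cases
    case 1
    then show ?thesis using cf_pumpable_frontier[OF LR] by (simp add: decomposable_def)
  next
    case 2
    moreover have "segment x p (m + n0) p1" using seg_step[OF e(1)] 2 by blast
    moreover have "m + n = (m + n0) + m' + n2" using 2 by simp
    ultimately show ?thesis unfolding decomposable_def by blast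
  next
    case 3
    moreover have "m + n = 0 + m + n" by simp
    ultimately show ?thesis unfolding decomposable_def using e seg_refl[OF wf] by blast
  next
    case (4 Z)
    have Z: "\<exists>u k m. segment x p k (z, u) \<and> segment x (z, u) m r \<and> m > 0" if "z \<in> Z" for z
      using 4(4) that seg_step[OF e(1)] by blast
    consider "m = 0" | "m > 0" "fst p \<in> Z" | "m > 0" "fst p \<notin> Z" by blast
    then show ?thesis
    proof cases
      case 1
      then have "m + n \<le> M * card Z" using 4 by simp
      then show ?thesis unfolding decomposable_def using Z 4(2) by blast
    next
      case 2
      then obtain u k where "segment x q k (fst p, u)" using 4(4) by blast
      then have "segment x p (m + k) (fst p, u)" using seg_step[OF e(1)] by blast
      then have "cf_pumpable x p" using cf_pumpable_segment 2 by blast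
      then show ?thesis by (simp add: decomposable_def)
    next
      case 3
      have "finite Z" using 4(2) finite_V finite_subset by blast
      then have "m + n \<le> M * card (insert (fst p) Z)" using 3 4 by simp
      moreover have "insert (fst p) Z \<subseteq> V" using 4(2) wf by simp
      moreover have "segment x p 0 (fst p, snd p) \<and> segment x (fst p, snd p) (m + n) r \<and> m + n > 0"
        using seg_refl[OF wf] seg_step[OF e(1,3)] 3 by simp
      then have "\<forall>z\<in>insert (fst p) Z. \<exists>u k m. segment x p k (z, u) \<and> segment x (z, u) m r \<and> m > 0"
        using Z by blast
      ultimately show ?thesis unfolding decomposable_def by blast
    qed
  qed
qed

lemma decomposable_refl: "wf_at x [p] \<Longrightarrow> decomposable T M x p 0 p"
  unfolding decomposable_def by (intro disjI2 exI[of _ "{}"]) auto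

section \<open>Chains of nested stack levels\<close>

text \<open>In a level \<open>(X, x, Q, k, Q')\<close> the symbol \<open>X\<close> with stack \<open>x\<close> is the pushing node on the path,
  \<open>Q @ k # Q'\<close> are the nodes at which the derivation below it returns to the stack \<open>x\<close>, and \<open>k\<close> is the
  one on the path.\<close>

fun valid_level :: "('n, 't, 'f) level \<Rightarrow> bool" where
  "valid_level (X, x, Q, k, Q') \<longleftrightarrow>
    X \<in> V \<and> wf_at x (Q @ k # Q') \<and> consumes [] [X] (map fst (Q @ k # Q'))"

text \<open>The lists \<open>\<alpha>\<close> and \<open>\<beta>\<close> stem from the branches leaving the path while \<open>s\<close> is pushed, \<open>\<mu>1\<close> and
  \<open>\<mu>2\<close> from those leaving it while \<open>s\<close> is popped. Only marks in these make the link pumpable.\<close>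

fun link :: "'f list \<Rightarrow> bool \<Rightarrow> ('n, 't, 'f) level \<Rightarrow> ('n, 't, 'f) level \<Rightarrow> bool" where
  "link s g (X, x, Q1, k, Q2) (X', x', Q1', k', Q2') \<longleftrightarrow> x' = s @ x \<and>
    (\<exists>\<alpha> \<rho>1 \<mu>1 \<mu>2 \<rho>2 \<beta>. Q1 = \<alpha> @ concat \<rho>1 @ \<mu>1 \<and> Q2 = \<mu>2 @ concat \<rho>2 @ \<beta> \<and>
      list_all2 (frontier s x) Q1' \<rho>1 \<and> list_all2 (frontier s x) Q2' \<rho>2 \<and>
      frontier s x k' (\<mu>1 @ k # \<mu>2) \<and>
      (\<forall>y. inst [X] y \<Rightarrow>\<^sub>G inst (map fst \<alpha>) y @ inst [X'] (s @ y) @ inst (map fst \<beta>) y) \<and>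
      (g \<longrightarrow> marked (yield (\<alpha> @ \<mu>1 @ \<mu>2 @ \<beta>))))"

text \<open>The side branches of the second link hang at stack \<open>s @ x\<close>; cut down to
  \<open>x\<close>, they become side branches of the composite. Cuts preserve yields, so a mark of
  either link survives.\<close>

lemma link_trans:
  assumes "link s g l1 l2" "link s' g' l2 l3"
  shows "link (s' @ s) (g \<or> g') l1 l3"
proof -
  obtain X x Q1 k Q2 where l1: "l1 = (X, x, Q1, k, Q2)" by (cases l1)
  obtain X' x' Q1' k' Q2' where l2: "l2 = (X', x', Q1', k', Q2')" by (cases l2)
  obtain X'' x'' Q1'' k'' Q2'' where l3: "l3 = (X'', x'', Q1'', k'', Q2'')" by (cases l3)
  obtain \<alpha> \<rho>1 \<mu>1 \<mu>2 \<rho>2 \<beta> where a: "x' = s @ x" "Q1 = \<alpha> @ concat \<rho>1 @ \<mu>1" "Q2 = \<mu>2 @ concat \<rho>2 @ \<beta>"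
      "list_all2 (frontier s x) Q1' \<rho>1" "list_all2 (frontier s x) Q2' \<rho>2"
      "frontier s x k' (\<mu>1 @ k # \<mu>2)"
      "\<And>y. inst [X] y \<Rightarrow>\<^sub>G inst (map fst \<alpha>) y @ inst [X'] (s @ y) @ inst (map fst \<beta>) y"
      "g \<longrightarrow> marked (yield (\<alpha> @ \<mu>1 @ \<mu>2 @ \<beta>))"
    using assms(1) unfolding l1 l2 link.simps by blast
  obtain \<alpha>' \<rho>1' \<mu>1' \<mu>2' \<rho>2' \<beta>' where b: "x'' = s' @ x'" "Q1' = \<alpha>' @ concat \<rho>1' @ \<mu>1'"
      "Q2' = \<mu>2' @ concat \<rho>2' @ \<beta>'"
      "list_all2 (frontier s' x') Q1'' \<rho>1'" "list_all2 (frontier s' x') Q2'' \<rho>2'"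
      "frontier s' x' k'' (\<mu>1' @ k' # \<mu>2')"
      "\<And>y. inst [X'] y \<Rightarrow>\<^sub>G inst (map fst \<alpha>') y @ inst [X''] (s' @ y) @ inst (map fst \<beta>') y"
      "g' \<longrightarrow> marked (yield (\<alpha>' @ \<mu>1' @ \<mu>2' @ \<beta>'))"
    using assms(2) unfolding l2 l3 link.simps by blast
  \<comment> \<open>The cuts of \<open>Q1'\<close> follow its decomposition in the second link: the
    outer parts join \<alpha> and \<mu>1, the middle part is regrouped by the nodes of
    \<open>Q1''\<close>.\<close>
  obtain a1 a2 a3 where A: "\<rho>1 = a1 @ a2 @ a3" "list_all2 (frontier s x) \<alpha>' a1"
    "list_all2 (frontier s x) (concat \<rho>1') a2" "list_all2 (frontier s x) \<mu>1' a3"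
    using a(4) unfolding b(2) by (auto simp: list_all2_append1)
  obtain b1 b2 b3 where B: "\<rho>2 = b1 @ b2 @ b3" "list_all2 (frontier s x) \<mu>2' b1"
    "list_all2 (frontier s x) (concat \<rho>2') b2" "list_all2 (frontier s x) \<beta>' b3"
    using a(5) unfolding b(3) by (auto simp: list_all2_append1)
  obtain \<tau>1 \<tau>2 where t: "list_all2 (frontier (s' @ s) x) Q1'' \<tau>1" "concat \<tau>1 = concat a2"
    "list_all2 (frontier (s' @ s) x) Q2'' \<tau>2" "concat \<tau>2 = concat b2"
    using cuts_trans[OF b(4)[unfolded a(1)] A(3)] cuts_trans[OF b(5)[unfolded a(1)] B(3)] by blast
  have "list_all2 (frontier s x) (\<mu>1' @ k' # \<mu>2') (a3 @ (\<mu>1 @ k # \<mu>2) # b1)"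
    using A(4) B(2) a(6) by (auto intro!: list_all2_appendI)
  from cut_trans[OF b(6)[unfolded a(1)] this]
  have k: "frontier (s' @ s) x k'' ((concat a3 @ \<mu>1) @ k # (\<mu>2 @ concat b1))" by simp
  have d: "inst [X] y \<Rightarrow>\<^sub>G inst (map fst (\<alpha> @ concat a1)) y @ inst [X''] ((s' @ s) @ y) @
      inst (map fst (concat b3 @ \<beta>)) y" for y
  proof -
    have "inst (map fst \<alpha>') (s @ y) @ inst [X''] (s' @ s @ y) @ inst (map fst \<beta>') (s @ y) \<Rightarrow>\<^sub>G
        inst (map fst (concat a1)) y @ inst [X''] (s' @ s @ y) @ inst (map fst (concat b3)) y"
      using cuts_concat(3)[OF A(2)] cuts_concat(3)[OF B(4)]
      by (intro derives_append) (auto simp: consumes_def)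
    then have "inst [X'] (s @ y) \<Rightarrow>\<^sub>G
        inst (map fst (concat a1)) y @ inst [X''] (s' @ s @ y) @ inst (map fst (concat b3)) y"
      using b(7)[of "s @ y"] by (meson rtranclp_trans)
    from derives_context[OF this, of "inst (map fst \<alpha>) y" "inst (map fst \<beta>) y"]
    show ?thesis using a(7)[of y] by (simp del: map_concat)
  qed
  have m: "g \<or> g' \<longrightarrow> marked (yield ((\<alpha> @ concat a1) @ (concat a3 @ \<mu>1) @ (\<mu>2 @ concat b1) @ (concat b3 @ \<beta>)))"
    using a(8) b(8) cuts_concat(2)[OF A(2)] cuts_concat(2)[OF A(4)] cuts_concat(2)[OF B(2)]
      cuts_concat(2)[OF B(4)] by auto
  have q: "Q1 = (\<alpha> @ concat a1) @ concat \<tau>1 @ (concat a3 @ \<mu>1)"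
    "Q2 = (\<mu>2 @ concat b1) @ concat \<tau>2 @ (concat b3 @ \<beta>)" "x'' = (s' @ s) @ x"
    using a b t A B by auto
  show ?thesis unfolding l1 l3 link.simps
    using q t(1,3) k d m by blast
qed

text \<open>The path runs from \<open>p\<close> via \<open>p'\<close> to \<open>p1\<close>, through
  the inner level to \<open>p2\<close>, and on to \<open>q'\<close>, where \<open>f\<close> is
  popped. Branches leaving it before \<open>p1\<close> become \<alpha> and \<beta>, those between
  \<open>p2\<close> and \<open>q\<close> become \<mu>1 and \<mu>2.\<close>

lemma link_push:
  assumes p: "wf_at x [p]" "pushes (fst p) f (fst p')" "snd p' = snd p"
    and seg1: "segment (f # x) p' n1 p1"
    and lev: "valid_level (fst p1, f # x, Q1', p2, Q2')" "yield (Q1' @ p2 # Q2') = snd p1"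
    and seg2: "segment (f # x) p2 n2 q'"
    and pop: "frontier [f] x q' (L @ q # R)"
  shows "\<exists>Q1 Q2. valid_level (fst p, x, Q1, q, Q2) \<and> yield (Q1 @ q # Q2) = snd p \<and>
    link [f] (n1 > 0 \<or> n2 > 0 \<or> marked (yield (L @ R))) (fst p, x, Q1, q, Q2) (fst p1, f # x, Q1', p2, Q2')"
proof -
  obtain L1 R1 where s1: "frontier [] ([f] @ x) p' (L1 @ p1 # R1)" "n1 > 0 \<longrightarrow> marked (yield (L1 @ R1))"
    using excursion_segment_frontier(2)[OF seg1] by auto
  obtain L2 R2 where s2: "frontier [] ([f] @ x) p2 (L2 @ q' # R2)" "n2 > 0 \<longrightarrow> marked (yield (L2 @ R2))"
    using excursion_segment_frontier(2)[OF seg2] by auto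
  obtain L2' R2' where k: "frontier [f] x p2 ((L2' @ L) @ q # (R @ R2'))" "yield L2' = yield L2"
    "yield R2' = yield R2" using cut_refine[OF s2(1) pop] by blast
  have wf: "wf_at ([f] @ x) L1" "wf_at ([f] @ x) R1" "wf_at ([f] @ x) Q1'" "wf_at ([f] @ x) Q2'"
    using s1 lev by (auto simp: frontier_def)
  obtain a b \<rho>1 \<rho>2 where c: "list_all2 (frontier [f] x) L1 a" "list_all2 (frontier [f] x) R1 b"
    "list_all2 (frontier [f] x) Q1' \<rho>1" "list_all2 (frontier [f] x) Q2' \<rho>2"
    using wf[THEN cuts_exist] by blast
  define \<mu>1 \<mu>2 where "\<mu>1 = L2' @ L" and "\<mu>2 = R @ R2'"
  define Q1 where "Q1 = concat a @ concat \<rho>1 @ \<mu>1"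
  define Q2 where "Q2 = \<mu>2 @ concat \<rho>2 @ concat b"
  have "frontier [] ([f] @ x) p1 (Q1' @ p2 # Q2')" using lev by (auto simp: frontier_def)
  moreover have "list_all2 (frontier [f] x) (Q1' @ p2 # Q2') (\<rho>1 @ (\<mu>1 @ q # \<mu>2) # \<rho>2)"
    using c k by (auto intro!: list_all2_appendI simp: \<mu>1_def \<mu>2_def)
  ultimately have "frontier [f] x p1 (concat (\<rho>1 @ (\<mu>1 @ q # \<mu>2) # \<rho>2))"
    using cut_trans[of "[]"] by fastforce
  then have "list_all2 (frontier [f] x) (L1 @ p1 # R1) (a @ (concat (\<rho>1 @ (\<mu>1 @ q # \<mu>2) # \<rho>2)) # b)"
    using c by (auto intro!: list_all2_appendI)
  from cut_trans[OF s1(1) this] have "frontier [f] x p' (Q1 @ q # Q2)"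
    by (simp add: Q1_def Q2_def)
  then have fr: "frontier [] x p (Q1 @ q # Q2)" using frontier_push[OF p(2,3)] by simp
  have d: "inst [fst p] y \<Rightarrow>\<^sub>G inst (map fst (concat a)) y @ inst [fst p1] ([f] @ y) @ inst (map fst (concat b)) y" for y
  proof -
    have 1: "inst [fst p] y \<Rightarrow>\<^sub>G inst [fst p'] ([f] @ y)" using p(2) by (simp add: pushes_def)
    have 2: "inst [fst p'] ([f] @ y) \<Rightarrow>\<^sub>G
        inst (map fst L1) ([f] @ y) @ inst [fst p1] ([f] @ y) @ inst (map fst R1) ([f] @ y)"
      using s1(1) by (simp add: frontier_def consumes_def inst_Cons[of _ "map fst R1"])
    have 3: "inst (map fst L1) ([f] @ y) @ inst [fst p1] ([f] @ y) @ inst (map fst R1) ([f] @ y) \<Rightarrow>\<^sub>G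
        inst (map fst (concat a)) y @ inst [fst p1] ([f] @ y) @ inst (map fst (concat b)) y"
      using cuts_concat(3)[OF c(1)] cuts_concat(3)[OF c(2)] unfolding consumes_def
      by (intro derives_append) auto
    show ?thesis using 1 2 3 by (meson rtranclp_trans)
  qed
  have m: "n1 > 0 \<or> n2 > 0 \<or> marked (yield (L @ R)) \<longrightarrow> marked (yield (concat a @ \<mu>1 @ \<mu>2 @ concat b))"
    using k s1 s2 cuts_concat(2)[OF c(1)] cuts_concat(2)[OF c(2)] by (auto simp: \<mu>1_def \<mu>2_def)
  have "link [f] (n1 > 0 \<or> n2 > 0 \<or> marked (yield (L @ R))) (fst p, x, Q1, q, Q2) (fst p1, f # x, Q1', p2, Q2')"
    unfolding link.simps using append_Cons[of f "[]" x, symmetric] Q1_def Q2_def c(3,4)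
      k(1)[folded \<mu>1_def \<mu>2_def] d m unfolding append_Nil by blast
  moreover have "valid_level (fst p, x, Q1, q, Q2)" "yield (Q1 @ q # Q2) = snd p"
    using fr p by (auto simp: frontier_def)
  ultimately show ?thesis by blast
qed

section \<open>From many branchings to a long chain of levels\<close>

text \<open>Any two levels, not only neighbours, have a mark between them, so that the pigeonhole
  principle may select any pair.\<close>

definition chain where
  "chain ls x p q \<longleftrightarrow> ls \<noteq> [] \<and> sorted_wrt (\<lambda>a b. \<exists>s. link s True a b) ls \<and> (\<forall>l\<in>set ls. valid_level l) \<and>
    (\<exists>Q1 Q2. hd ls = (fst p, x, Q1, q, Q2) \<and> yield (Q1 @ q # Q2) = snd p)"

text \<open>This many branchings in an excursion force \<open>Suc k\<close> nested levels or a
  context-free pump. In the recursion, the product is what a segment can have without a larger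
  excursion or a repeated symbol; the 2 allows for the branching at the final pop and for a strict
  excess.\<close>

primrec threshold :: "nat \<Rightarrow> nat" where
  "threshold 0 = 0"
| "threshold (Suc k) = threshold k * card V + 2"

text \<open>A segment with too many branchings contains a large excursion; inside a push, this
  excursion has a chain by induction. The level of the push is put before that chain, or replaces
  its first level if no branching separates the two.\<close>

lemma excursion_chain:
  "excursion x p m q \<Longrightarrow> threshold k \<le> m \<Longrightarrow>
    cf_pumpable x p \<or> (\<exists>ls. length ls = Suc k \<and> chain ls x p q)"
  "segment x p m q \<Longrightarrow> decomposable (\<lambda>x p m q. \<forall>k. threshold k \<le> m \<longrightarrow>
    cf_pumpable x p \<or> (\<exists>ls. length ls = Suc k \<and> chain ls x p q)) M x p m q"
proof (induct arbitrary: k and M rule: excursion_segment.inducts)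
  case (exc_plain x p L q R)
  \<comment> \<open>A plain step has at most one branching, and every
    \<open>threshold (Suc j)\<close> is at least 2.\<close>
  have "k = 0" using exc_plain by (cases k) (auto simp: of_bool_def split: if_splits)
  moreover have "chain [(fst p, x, L, q, R)] x p q"
    using exc_plain by (auto simp: chain_def frontier_def)
  ultimately show ?case by (intro disjI2 exI[of _ "[(fst p, x, L, q, R)]"]) auto
next
  case (exc_push x p f p' n q' L q R)
  let ?g = "marked (yield (L @ R))"
  show ?case
  proof (cases k)
    case 0
    have "excursion x p (n + of_bool ?g) q" using exc_push excursion_segment.exc_push by blast
    then obtain L R where "wf_at x [p]" "frontier [] x p (L @ q # R)"
      using excursion_segment_frontier(1) by blast
    then have "chain [(fst p, x, L, q, R)] x p q" by (auto simp: chain_def frontier_def)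
    then show ?thesis using 0 by (intro disjI2 exI[of _ "[(fst p, x, L, q, R)]"]) auto
  next
    case (Suc k')
    have n: "n > threshold k' * card V" using exc_push.prems Suc
      by (auto simp: of_bool_def split: if_splits)
    from exc_push.hyps(5)[of "threshold k'"] consider "cf_pumpable (f # x) p'"
      | n0 p1 m p2 n2 where "threshold k' < m" "segment (f # x) p' n0 p1"
        "\<And>k. threshold k \<le> m \<Longrightarrow> cf_pumpable (f # x) p1 \<or> (\<exists>ls. length ls = Suc k \<and> chain ls (f # x) p1 p2)"
        "segment (f # x) p2 n2 q'" "n = n0 + m + n2"
      | Z where "Z \<subseteq> V" "n \<le> threshold k' * card Z"
      unfolding decomposable_def by blast
    then show ?thesis
    proof cases
      case 1
      then show ?thesis using cf_pumpable_push exc_push.hyps by blast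
    next
      case (2 n0 p1 m p2 n2)
      show ?thesis
      proof (cases "cf_pumpable (f # x) p1")
        case True
        obtain L1 R1 where "frontier [] (f # x) p' (L1 @ p1 # R1)"
          using excursion_segment_frontier(2)[OF 2(2)] by blast
        then have "cf_pumpable (f # x) p'" using cf_pumpable_frontier True by blast
        then show ?thesis using cf_pumpable_push exc_push.hyps by blast
      next
        case False
        have ex: "\<exists>ls. length ls = Suc j \<and> chain ls (f # x) p1 p2" if "threshold j \<le> m" for j
          using 2(3) False that by blast
        let ?h = "n0 > 0 \<or> n2 > 0 \<or> ?g"
        have lk: "\<exists>l. valid_level l \<and> (\<exists>Q1 Q2. l = (fst p, x, Q1, q, Q2) \<and> yield (Q1 @ q # Q2) = snd p) \<and>
            link [f] ?h l (hd ls)" if c: "chain ls (f # x) p1 p2" for ls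
        proof -
          obtain Q1' Q2' where h: "hd ls = (fst p1, f # x, Q1', p2, Q2')"
            and y: "yield (Q1' @ p2 # Q2') = snd p1"
            using c unfolding chain_def by blast
          moreover have "valid_level (hd ls)" using c by (auto simp: chain_def)
          ultimately have "valid_level (fst p1, f # x, Q1', p2, Q2')" by simp
          from link_push[OF exc_push.hyps(1-3) 2(2) this y 2(4) exc_push.hyps(6)] h
          show ?thesis by metis
        qed
        show ?thesis
        proof (cases ?h)
          case True
          obtain ls where ls: "length ls = Suc k'" "chain ls (f # x) p1 p2" using ex 2(1) by force
          obtain l where l: "valid_level l" "\<exists>Q1 Q2. l = (fst p, x, Q1, q, Q2) \<and> yield (Q1 @ q # Q2) = snd p"
            "link [f] True l (hd ls)" using lk[OF ls(2)] True by auto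
          have "\<exists>s. link s True l l'" if "l' \<in> set ls" for l'
          proof (cases "l' = hd ls")
            case True
            then show ?thesis using l by blast
          next
            case False
            with that have "l' \<in> set (tl ls)" by (cases ls) auto
            moreover have "\<forall>l'\<in>set (tl ls). \<exists>s. link s True (hd ls) l'"
              using ls(2) by (cases ls) (simp_all add: chain_def)
            ultimately obtain s where "link s True (hd ls) l'" by blast
            then show ?thesis using link_trans[OF l(3)] by (metis simp_thms(31))
          qed
          then have "chain (l # ls) x p q" using ls l by (auto simp: chain_def)
          then show ?thesis using ls Suc by (intro disjI2 exI[of _ "l # ls"]) auto
        next
          case False
          \<comment> \<open>All branchings lie in the inner excursion, so the hypothesis applies
            with \<open>k\<close> itself instead of \<open>k'\<close>. The chain is long enough
            already; only its first level is exchanged for one at stack \<open>x\<close>.\<close>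
          then have "m = n + of_bool ?g" using 2 by auto
          then obtain ls where ls: "length ls = Suc k" "chain ls (f # x) p1 p2"
            using ex exc_push.prems by blast
          obtain l where l: "valid_level l" "\<exists>Q1 Q2. l = (fst p, x, Q1, q, Q2) \<and> yield (Q1 @ q # Q2) = snd p"
            "link [f] False l (hd ls)" using lk[OF ls(2)] False by auto
          obtain l0 ls' where ls': "ls = l0 # ls'" using ls by (cases ls) auto
          have "\<exists>s. link s True l l'" if l': "l' \<in> set ls'" for l'
          proof -
            have "\<forall>l'\<in>set ls'. \<exists>s. link s True l0 l'" using ls(2) by (simp add: chain_def ls')
            then obtain s where "link s True l0 l'" using l' by blast
            then show ?thesis using link_trans[of "[f]" False l l0 s True l'] l(3) ls'
              by (metis list.sel(1) simp_thms(31))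
          qed
          then have "chain (l # ls') x p q" using ls l by (auto simp: chain_def ls')
          then show ?thesis using ls ls' by (intro disjI2 exI[of _ "l # ls'"]) auto
        qed
      qed
    next
      case (3 Z)
      then have "n \<le> threshold k' * card V"
        using card_mono[OF finite_V, of Z] by (meson le_trans mult_le_mono2)
      then show ?thesis using n by simp
    qed
  qed
next
  case (seg_refl x p)
  then show ?case by (rule decomposable_refl)
next
  case (seg_step x p m q n r)
  show ?case using seg_step.hyps by (intro decomposable_step[OF seg_step.hyps(1) _ seg_step.hyps(3)]) auto
qed

end

section \<open>Branching paths\<close>

lemma map_nth_upt: "map (\<lambda>j. g (xs ! j)) [0..<length xs] = map g xs"
  by (rule nth_equalityI) auto

text \<open>If one child carries \<open>d ^ n\<close> marks, the path follows it at no cost.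
  Otherwise some child carries a \<open>d\<close>-th part of that number, and as it does not carry
  all marks, its siblings carry one: the lost factor is paid for by a branching.\<close>

lemma marked_split:
  assumes "d > 0" "length Q \<le> d" "d ^ n \<le> marks (yield Q)"
  shows "\<exists>L p R k. Q = L @ p # R \<and> d ^ k \<le> marks (snd p) \<and> n \<le> of_bool (marked (yield (L @ R))) + k"
proof (cases "\<exists>p\<in>set Q. d ^ n \<le> marks (snd p)")
  case True
  then obtain p L R where "Q = L @ p # R" "d ^ n \<le> marks (snd p)" by (metis split_list)
  then show ?thesis by (intro exI[of _ L] exI[of _ p] exI[of _ R] exI[of _ n]) auto
next
  case False
  have bound: "marks (yield Q) \<le> length Q * c" if "\<forall>p\<in>set Q. marks (snd p) \<le> c" for c
    using that by (induction Q) auto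
  have "n \<noteq> 0"
  proof
    assume "n = 0"
    then show False using False bound[of 0] assms(3) by (auto simp: not_less_eq_eq)
  qed
  then obtain k where n: "n = Suc k" by (cases n) auto
  have "\<exists>p\<in>set Q. d ^ k \<le> marks (snd p)"
  proof (rule ccontr)
    assume "\<not> ?thesis"
    then have "\<forall>p\<in>set Q. marks (snd p) \<le> d ^ k - 1" by force
    then have "marks (yield Q) \<le> d * (d ^ k - 1)"
      using bound assms(2) by (meson le_trans mult_le_mono1)
    also have "\<dots> < d * d ^ k" using assms(1) by simp
    finally show False using assms(3) n by simp
  qed
  then obtain p L R where Q: "Q = L @ p # R" and p: "d ^ k \<le> marks (snd p)" by (metis split_list)
  have "marks (snd p) < marks (yield Q)" using False assms(3) Q by force
  then have "marked (yield (L @ R))" using Q by (auto simp: marked_iff_marks)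
  then show ?thesis using Q p n by (intro exI[of _ L] exI[of _ p] exI[of _ R] exI[of _ k]) auto
qed

context indexed_grammar
begin

text \<open>Paths to a leaf. Terminals may pop freely, so that every path ends with the empty stack.\<close>

inductive descent :: "'f list \<Rightarrow> ('n, 't) node \<Rightarrow> nat \<Rightarrow> bool" where
  descent_bottom: "segment [] p n q \<Longrightarrow> descent [] p n"
| descent_pop: "segment (f # x) p n q \<Longrightarrow> frontier [f] x q (L @ q' # R) \<Longrightarrow> descent x q' n' \<Longrightarrow>
    descent (f # x) p (n + of_bool (marked (yield (L @ R))) + n')"

lemma descent_excursion:
  assumes "excursion x p m q" "descent x q n"
  shows "descent x p (m + n)"
  using assms(2)
proof cases
  case (descent_bottom r)
  then show ?thesis using descent.descent_bottom seg_step[OF assms(1)] by blast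
next
  case (descent_pop f y n1 r L r' R n')
  then show ?thesis
    using descent.descent_pop[of f y p "m + n1" r L r' R n'] seg_step[OF assms(1)] by (simp add: add.assoc)
qed

text \<open>The path below the push must pop \<open>f\<close>; up to that pop it is an excursion
  from \<open>p\<close>.\<close>

lemma descent_push:
  assumes "wf_at x [p]" "pushes (fst p) f (fst p')" "snd p' = snd p" "descent (f # x) p' n"
  shows "descent x p n"
  using assms(4)
proof cases
  case (descent_pop n1 q L q' R n')
  then show ?thesis using descent_excursion[OF exc_push[OF assms(1-3)]] by blast
qed

lemma descent_terminal: "Inr a \<in> V \<Longrightarrow> descent x (Inr a, [(a, b)]) 0"
proof (induction x)
  case Nil
  then show ?case by (intro descent_bottom[OF seg_refl]) (simp add: generates_Inr_iff)
next
  case (Cons f x)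
  have "frontier [f] x (Inr a, [(a, b)]) ([] @ (Inr a, [(a, b)]) # [])"
    using Cons by (simp add: frontier_def consumes_def generates_Inr_iff)
  moreover have "segment (f # x) (Inr a, [(a, b)]) 0 (Inr a, [(a, b)])"
    using Cons by (intro seg_refl) (simp add: generates_Inr_iff)
  ultimately show ?case using descent_pop[of f x "(Inr a, [(a, b)])" 0 _ "[]" _ "[]" 0] Cons by simp
qed

text \<open>The path takes at every plain or pop step the child given by
  \<open>marked_split\<close>. A factor \<open>d\<close> of marks is spent only at a
  branching.\<close>

lemma descent_exists:
  assumes d: "d \<ge> 2" "\<forall>A r. Plain A r \<in> P \<longrightarrow> length r \<le> d"
    "\<forall>A f r. Pop A f r \<in> P \<longrightarrow> length r \<le> d"
  shows "generates X x v \<Longrightarrow> X \<in> V \<Longrightarrow> d ^ n \<le> marks v \<Longrightarrow> \<exists>n'\<ge>n. descent x (X, v) n'"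
proof (induction arbitrary: n rule: generates.induct)
  case (gen_terminal a x b)
  have "marks [(a, b)] \<le> 1" by (simp add: marks_def)
  then have "d ^ n \<le> 1" using gen_terminal by simp
  \<comment> \<open>A leaf has at most one mark, so with \<open>d\<close> at least 2 no branching
    remains to be found.\<close>
  then have "n = 0" using d(1) one_less_power[of d n] by force
  then show ?case using descent_terminal gen_terminal by blast
next
  case (gen_plain A Q x)
  have V: "\<forall>p\<in>set Q. fst p \<in> V" using V_I(2)[OF gen_plain.hyps] by auto
  have len: "length Q \<le> d" using d(2) gen_plain.hyps by (metis length_map)
  obtain L p R k where Q: "Q = L @ p # R" "d ^ k \<le> marks (snd p)"
    "n \<le> of_bool (marked (yield (L @ R))) + k"
    using marked_split[OF _ len] d(1) gen_plain.prems(2) by force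
  obtain n' where n': "n' \<ge> k" "descent x p n'" using gen_plain.IH V Q by fastforce
  have "wf_at x [(Inl A, yield Q)]" "frontier [] x (Inl A, yield Q) (L @ p # R)"
    using gen_plain V generates.gen_plain[of A Q x] step_plain[OF gen_plain.hyps] Q(1)
    by (auto simp: frontier_def wf_at_def consumes_def)
  from descent_excursion[OF exc_plain[OF this] n'(2)] n'(1) Q(3) show ?case
    by (intro exI conjI) auto
next
  case (gen_push A B f x v)
  have "Inl B \<in> V" using V_I(3)[OF gen_push.hyps(1)] by simp
  then obtain n' where n': "n' \<ge> n" "descent (f # x) (Inl B, v) n'"
    using gen_push by blast
  moreover have "wf_at x [(Inl A, v)]"
    using gen_push.prems generates.gen_push[OF gen_push.hyps] by simp
  moreover have "pushes (Inl A) f (Inl B)" using step_push[OF gen_push.hyps(1)] by (simp add: pushes_def)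
  ultimately show ?case using descent_push[of x "(Inl A, v)" f "(Inl B, v)" n'] by auto
next
  case (gen_pop A f Q x)
  have V: "\<forall>p\<in>set Q. fst p \<in> V" using V_I(4)[OF gen_pop.hyps] by auto
  have len: "length Q \<le> d" using d(3) gen_pop.hyps by (metis length_map)
  obtain L p R k where Q: "Q = L @ p # R" "d ^ k \<le> marks (snd p)"
    "n \<le> of_bool (marked (yield (L @ R))) + k"
    using marked_split[OF _ len] d(1) gen_pop.prems(2) by force
  obtain n' where n': "n' \<ge> k" "descent x p n'" using gen_pop.IH V Q by fastforce
  have "wf_at (f # x) [(Inl A, yield Q)]" "frontier [f] x (Inl A, yield Q) (L @ p # R)"
    using gen_pop V generates.gen_pop[of A f Q x] step_pop[OF gen_pop.hyps] Q(1)
    by (auto simp: frontier_def wf_at_def consumes_def)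
  from descent_pop[OF seg_refl[OF this(1)] this(2) n'(2)] n'(1) Q(3) show ?case
    by (intro exI conjI) auto
qed

lemma long_chain_exists:
  "\<exists>N. \<forall>w. map fst w \<in> lang P S \<and> N \<le> marks w \<longrightarrow> cf_pumpable [] (Inl S, w) \<or>
    (\<exists>L p R ls q. frontier [] [] (Inl S, w) (L @ p # R) \<and> length ls = Suc k \<and> chain ls [] p q)"
proof -
  define rhs :: "('n, 't, 'f) production \<Rightarrow> nat" where
    "rhs p = (case p of Plain A r \<Rightarrow> length r | Push A B f \<Rightarrow> 0 | Pop A f r \<Rightarrow> length r)" for p
  obtain d0 where d0: "\<forall>p\<in>P. rhs p \<le> d0"
    using finite_P finite_nat_set_iff_bounded_le[of "rhs ` P"] by auto
  define d where "d = max 2 d0"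
  have d: "d \<ge> 2" "\<forall>A r. Plain A r \<in> P \<longrightarrow> length r \<le> d"
    "\<forall>A f r. Pop A f r \<in> P \<longrightarrow> length r \<le> d"
    using d0 by (force simp: rhs_def d_def)+
  \<comment> \<open>One more than a segment can have without a context-free pump or an excursion of
    more than \<open>threshold k\<close> branchings.\<close>
  let ?n = "threshold k * card V + 1"
  have "cf_pumpable [] (Inl S, w) \<or>
    (\<exists>L p R ls q. frontier [] [] (Inl S, w) (L @ p # R) \<and> length ls = Suc k \<and> chain ls [] p q)"
    if w: "map fst w \<in> lang P S" "d ^ ?n \<le> marks w" for w
  proof -
    obtain n' where n': "n' \<ge> ?n" "descent [] (Inl S, w) n'"
      using descent_exists[OF d, where X = "Inl S" and x = "[]" and v = w and n = ?n] w lang_generates V_I(1) by blast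
    \<comment> \<open>At the empty stack nothing can be popped, so the whole path is one
      segment.\<close>
    then obtain q' where seg: "segment [] (Inl S, w) n' q'" by (auto elim: descent.cases)
    from excursion_chain(2)[OF seg, of "threshold k"] consider "cf_pumpable [] (Inl S, w)"
      | n0 p1 m p2 where "threshold k < m" "segment [] (Inl S, w) n0 p1"
        "\<forall>k. threshold k \<le> m \<longrightarrow> cf_pumpable [] p1 \<or> (\<exists>ls. length ls = Suc k \<and> chain ls [] p1 p2)"
      | Z where "Z \<subseteq> V" "n' \<le> threshold k * card Z"
      unfolding decomposable_def by blast
    then show ?thesis
    proof cases
      case 2
      obtain L R where LR: "frontier [] [] (Inl S, w) (L @ p1 # R)"
        using excursion_segment_frontier(2)[OF 2(2)] by blast
      have "cf_pumpable [] p1 \<or> (\<exists>ls. length ls = Suc k \<and> chain ls [] p1 p2)"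
        using 2(1,3) by simp
      then show ?thesis using LR cf_pumpable_frontier[OF LR] by blast
    next
      case (3 Z)
      then have "n' \<le> threshold k * card V"
        using card_mono[OF finite_V, of Z] by (meson le_trans mult_le_mono2)
      then show ?thesis using n' by simp
    qed simp
  qed
  then show ?thesis by blast
qed

end

section \<open>Pumping factorizations\<close>

text \<open>A block is the list of the pairs \<open>(v\<^sub>i\<^sub>j, \<phi>(i, j))\<close> for fixed \<open>i\<close>, and \<open>expand B t i\<close> is \<open>u\<^sub>i\<close> after
  \<open>t\<close> substitutions.\<close>

primrec expand :: "('a list \<times> nat) list list \<Rightarrow> nat \<Rightarrow> nat \<Rightarrow> 'a list" where
  "expand B 0 i = concat (map fst (B ! i))"
| "expand B (Suc t) i = concat (map (\<lambda>c. expand B t (snd c)) (B ! i))"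

text \<open>The conclusion of the theorem for words with marked letters. A mark in
  \<open>b1 @ b2\<close> is a mark of the block outside the factor \<open>c\<close>.\<close>

definition pumping :: "'t list set \<Rightarrow> ('t \<times> bool) list \<Rightarrow> (('t \<times> bool) list \<times> nat) list list \<Rightarrow> bool" where
  "pumping L w B \<longleftrightarrow> B \<noteq> [] \<and> concat (map (expand B 0) [0..<length B]) = w \<and>
    (\<forall>b\<in>set B. \<forall>c\<in>set b. snd c < length B \<and> (marked (fst c) \<longrightarrow> marked (expand B 0 (snd c)))) \<and>
    (\<forall>t. map fst (concat (map (expand B t) [0..<length B])) \<in> L) \<and>
    (\<exists>i<length B. \<exists>b1 c b2. B ! i = b1 @ c # b2 \<and> snd c = i \<and> marked (concat (map fst (b1 @ b2))))"

section \<open>From marked letters to marked positions\<close>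

lemma marked_positions:
  assumes "map (\<lambda>k. (w ! k, k \<in> M)) [0..<length w] = a @ b @ c"
  shows "marked b \<longleftrightarrow> {length a..<length a + length b} \<inter> M \<noteq> {}"
proof -
  have len: "length w = length a + length b + length c"
    using arg_cong[OF assms, of length] by simp
  have "snd (b ! k) \<longleftrightarrow> length a + k \<in> M" if "k < length b" for k
  proof -
    have "b ! k = (a @ b @ c) ! (length a + k)" using that by (simp add: nth_append)
    also have "\<dots> = (w ! (length a + k), length a + k \<in> M)"
      unfolding assms[symmetric] using that len by simp
    finally show ?thesis by simp
  qed
  moreover have "marked b \<longleftrightarrow> (\<exists>k<length b. snd (b ! k))"
    unfolding marked_def by (metis in_set_conv_nth)
  ultimately have *: "marked b \<longleftrightarrow> (\<exists>k<length b. length a + k \<in> M)" by blast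
  show ?thesis unfolding *
  proof
    assume "\<exists>k<length b. length a + k \<in> M"
    then obtain k where "k < length b" "length a + k \<in> M" by blast
    then have "length a + k \<in> {length a..<length a + length b} \<inter> M" by simp
    then show "{length a..<length a + length b} \<inter> M \<noteq> {}" by blast
  next
    assume "{length a..<length a + length b} \<inter> M \<noteq> {}"
    then obtain j where "length a \<le> j" "j < length a + length b" "j \<in> M" by auto
    then show "\<exists>k<length b. length a + k \<in> M" by (intro exI[of _ "j - length a"]) auto
  qed
qed

text \<open>Both \<open>pump\<close> and \<open>expand\<close> replace a factor by its target block
  as it was one iteration earlier, so they agree up to marks. Positions are handled by splitting the
  word around a block or factor and applying \<open>marked_positions\<close>.\<close>

lemma pumping_factorization:
  fixes w :: "'t list" and M :: "nat set"
  assumes "pumping L (map (\<lambda>k. (w ! k, k \<in> M)) [0..<length w]) B"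
  shows "\<exists>(vs :: 't list list list) (\<phi> :: nat \<Rightarrow> nat \<Rightarrow> nat).
       length vs \<ge> 1 \<and> word_of vs = w \<and>
       (\<forall>i < length vs. \<forall>j < length (vs ! i). \<phi> i j < length vs) \<and>
       (\<forall>t. word_of (pump vs \<phi> t) \<in> L) \<and>
       (\<forall>i < length vs. \<forall>j < length (vs ! i).
          v_pos vs i j \<inter> M \<noteq> {} \<longrightarrow> u_pos vs (\<phi> i j) \<inter> M \<noteq> {}) \<and>
       (\<exists>i < length vs. \<exists>j < length (vs ! i). \<phi> i j = i \<and>
          (u_pos vs i - v_pos vs i j) \<inter> M \<noteq> {})"
proof -
  define vs where "vs = map (map (\<lambda>c. map fst (fst c))) B"
  define \<phi> where "\<phi> = (\<lambda>i j. snd (B ! i ! j))"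
  let ?w = "map (\<lambda>k. (w ! k, k \<in> M)) [0..<length w]"
  have B: "B \<noteq> []" "concat (map (expand B 0) [0..<length B]) = ?w"
    "\<And>b c. b \<in> set B \<Longrightarrow> c \<in> set b \<Longrightarrow> snd c < length B"
    "\<And>b c. b \<in> set B \<Longrightarrow> c \<in> set b \<Longrightarrow> marked (fst c) \<Longrightarrow> marked (expand B 0 (snd c))"
    "\<And>t. map fst (concat (map (expand B t) [0..<length B])) \<in> L"
    "\<exists>i<length B. \<exists>b1 c b2. B ! i = b1 @ c # b2 \<and> snd c = i \<and> marked (concat (map fst (b1 @ b2)))"
    using assms unfolding pumping_def by blast+
  have len: "length vs = length B" "\<And>i. i < length B \<Longrightarrow> length (vs ! i) = length (B ! i)"
    by (auto simp: vs_def)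
  have \<phi>: "\<phi> i j < length B" if "i < length B" "j < length (B ! i)" for i j
    using B(3)[of "B ! i" "B ! i ! j"] that by (simp add: \<phi>_def)
  have lp: "length (pump vs \<phi> t) = length B" for t by (cases t) (auto simp: len)
  have pe: "concat (pump vs \<phi> t ! i) = map fst (expand B t i)" if "i < length B" for t i
    using that
  proof (induction t arbitrary: i)
    case 0
    then show ?case by (simp add: vs_def map_concat comp_def)
  next
    case (Suc t)
    have "concat (pump vs \<phi> (Suc t) ! i) = concat (map (\<lambda>j. concat (pump vs \<phi> t ! \<phi> i j)) [0..<length (B ! i)])"
      using Suc.prems len by simp
    also have "\<dots> = concat (map (\<lambda>j. map fst (expand B t (snd (B ! i ! j)))) [0..<length (B ! i)])"
      using Suc.IH \<phi>[OF Suc.prems] by (intro arg_cong[of _ _ concat] map_cong) (auto simp: \<phi>_def)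
    also have "\<dots> = map fst (expand B (Suc t) i)"
      using map_nth_upt[of "\<lambda>c. map fst (expand B t (snd c))" "B ! i"] by (simp add: map_concat comp_def)
    finally show ?case .
  qed
  have word: "word_of (pump vs \<phi> t) = map fst (concat (map (expand B t) [0..<length B]))" for t
  proof -
    have "map concat (pump vs \<phi> t) = map (\<lambda>i. map fst (expand B t i)) [0..<length B]"
      by (rule nth_equalityI) (auto simp: lp pe)
    then show ?thesis by (simp add: word_of_def map_concat comp_def)
  qed
  let ?f = "\<lambda>b. concat (map fst b)"
  have w: "concat (map ?f B) = ?w"
  proof -
    have "expand B 0 = (\<lambda>j. ?f (B ! j))" by (rule ext) simp
    then show ?thesis using B(2) map_nth_upt[of ?f B] by simp
  qed
  have st: "u_start vs i = length (concat (map ?f (take i B)))" for i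
    by (simp add: u_start_def word_of_def vs_def take_map length_concat map_concat comp_def)
  have u_split: "?w = concat (map ?f (take i B)) @ ?f (B ! i) @ concat (map ?f (drop (Suc i) B))"
    if "i < length B" for i
    unfolding w[symmetric] by (subst id_take_nth_drop[OF that]) simp
  have u_pos: "u_pos vs i = {u_start vs i..<u_start vs i + length (?f (B ! i))}" if "i < length B" for i
    using that by (simp add: u_pos_def vs_def length_concat comp_def)
  have u_mark: "u_pos vs i \<inter> M \<noteq> {} \<longleftrightarrow> marked (?f (B ! i))" if "i < length B" for i
    using marked_positions[OF u_split[OF that]] by (simp only: u_pos[OF that] st)
  have v_pos: "v_pos vs i j = {u_start vs i + length (?f b1)..<u_start vs i + length (?f b1) + length (fst c)}"
    if "i < length B" "B ! i = b1 @ c # b2" "j = length b1" for i j b1 c b2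
    using that by (simp add: v_pos_def vs_def length_concat comp_def Let_def nth_append)
  have v_mark: "v_pos vs i j \<inter> M \<noteq> {} \<longleftrightarrow> marked (fst (B ! i ! j))"
    if "i < length B" "j < length (B ! i)" for i j
  proof -
    let ?b1 = "take j (B ! i)" and ?b2 = "drop (Suc j) (B ! i)"
    have b: "B ! i = ?b1 @ (B ! i ! j) # ?b2" using id_take_nth_drop[OF that(2)] .
    then have "?f (B ! i) = ?f ?b1 @ fst (B ! i ! j) @ ?f ?b2" by (metis concat.simps(2) concat_append list.simps(9) map_append)
    then have "?w = (concat (map ?f (take i B)) @ ?f ?b1) @ fst (B ! i ! j) @ (?f ?b2 @ concat (map ?f (drop (Suc i) B)))"
      using u_split[OF that(1)] by simp
    from marked_positions[OF this] show ?thesis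
      using v_pos[OF that(1) b] that(2) by (simp add: st)
  qed
  have mono: "u_pos vs (\<phi> i j) \<inter> M \<noteq> {}"
    if "i < length B" "j < length (B ! i)" "v_pos vs i j \<inter> M \<noteq> {}" for i j
    using that B(4)[of "B ! i" "B ! i ! j"] v_mark[of i j] u_mark[OF \<phi>[of i j]]
    by (simp add: \<phi>_def)
  obtain i b1 c b2 where i: "i < length B" "B ! i = b1 @ c # b2" "snd c = i"
    "marked (concat (map fst (b1 @ b2)))" using B(6) by blast
  have "(u_pos vs i - v_pos vs i (length b1)) \<inter> M \<noteq> {}"
  proof -
    note sp = u_split[OF i(1), unfolded i(2)]
    consider "marked (?f b1)" | "marked (?f b2)" using i(4) by auto
    then show ?thesis
    proof cases
      case 1
      have "?w = concat (map ?f (take i B)) @ ?f b1 @ (fst c @ ?f b2 @ concat (map ?f (drop (Suc i) B)))"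
        using sp by simp
      from marked_positions[OF this] 1
      have "{u_start vs i..<u_start vs i + length (?f b1)} \<inter> M \<noteq> {}" by (simp only: st)
      moreover have "{u_start vs i..<u_start vs i + length (?f b1)} \<subseteq> u_pos vs i - v_pos vs i (length b1)"
        using u_pos[OF i(1)] v_pos[OF i(1,2) refl] i(2) by auto
      ultimately show ?thesis by blast
    next
      case 2
      let ?s = "u_start vs i + length (?f b1) + length (fst c)"
      have "?w = (concat (map ?f (take i B)) @ ?f b1 @ fst c) @ ?f b2 @ concat (map ?f (drop (Suc i) B))"
        using sp by simp
      from marked_positions[OF this] 2
      have "{?s..<?s + length (?f b2)} \<inter> M \<noteq> {}" by (simp add: st add.assoc)
      moreover have "{?s..<?s + length (?f b2)} \<subseteq> u_pos vs i - v_pos vs i (length b1)"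
        using u_pos[OF i(1)] v_pos[OF i(1,2) refl] i(2) by auto
      ultimately show ?thesis by blast
    qed
  qed
  moreover have "\<phi> i (length b1) = i" "length b1 < length (vs ! i)"
    using i len by (auto simp: \<phi>_def)
  ultimately have "\<exists>i < length vs. \<exists>j < length (vs ! i). \<phi> i j = i \<and> (u_pos vs i - v_pos vs i j) \<inter> M \<noteq> {}"
    using i(1) len(1) by metis
  moreover have "word_of vs = w"
    using word[of 0] B(2) by (simp add: comp_def map_nth)
  moreover have "length vs \<ge> 1" using B(1) len by (cases B) auto
  ultimately show ?thesis
    using mono \<phi> B(5) word len by (intro exI[of _ vs] exI[of _ \<phi>]) simp
qed

context indexed_grammar
begin

section \<open>Pumping words of the language\<close>

lemma derives_lang:
  "[NI S []] \<Rightarrow>\<^sub>G terminals w \<Longrightarrow> map fst w \<in> lang P S"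
  by (simp add: lang_def terminals_def comp_def)

text \<open>The blocks are \<open>l\<close>, \<open>a\<close>, \<open>m\<close>, \<open>b\<close>,
  \<open>r\<close>, and all factors point to their own block. The empty factor beside
  \<open>a\<close> or \<open>b\<close> is then a fixed factor with a mark outside it.\<close>

lemma cf_pumpable_pumping:
  assumes "cf_pumpable [] (Inl S, w)"
  shows "\<exists>B. pumping (lang P S) w B"
proof -
  obtain l Y y a m b r where *: "w = l @ a @ m @ b @ r"
    "[NI S []] \<Rightarrow>\<^sub>G terminals l @ inst [Y] y @ terminals r"
    "inst [Y] y \<Rightarrow>\<^sub>G terminals a @ inst [Y] y @ terminals b"
    "inst [Y] y \<Rightarrow>\<^sub>G terminals m" "marked (a @ b)"
    using assms unfolding cf_pumpable_def by auto
  \<comment> \<open>The empty factors duplicate \<open>a\<close> and \<open>b\<close>: after \<open>t\<close> substitutions they occur \<open>2 ^ t\<close> times.\<close>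
  define B where "B = [[(l, 0)], [(a, 1), ([], 1)], [(m, 2)], [([], 3), (b, 3)], [(r, 4::nat)]]"
  have nth: "B ! 0 = [(l, 0)]" "B ! 1 = [(a, 1), ([], 1)]" "B ! 2 = [(m, 2)]"
    "B ! 3 = [([], 3), (b, 3)]" "B ! 4 = [(r, 4)]" "length B = 5"
    by (simp_all add: B_def numeral_eq_Suc)
  have up: "[0..<5] = [0, 1, 2, 3, 4::nat]" by (simp add: upt_rec)
  have e: "expand B t 0 = l" "expand B t 2 = m" "expand B t 4 = r" for t
    by (induction t) (auto simp: nth)
  have e1: "expand B 0 1 = a" "expand B 0 3 = b"
    "expand B (Suc t) 1 = expand B t 1 @ expand B t 1"
    "expand B (Suc t) 3 = expand B t 3 @ expand B t 3" for t
    unfolding expand.simps nth by simp_all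
  have d: "inst [Y] y \<Rightarrow>\<^sub>G terminals (expand B t 1) @ inst [Y] y @ terminals (expand B t 3)" for t
  proof (induction t)
    case 0
    then show ?case using *(3) e1 by simp
  next
    case (Suc t)
    show ?case unfolding e1
      using derives_context[OF Suc, of "terminals (expand B t 1)" "terminals (expand B t 3)"] Suc
      by (simp add: rtranclp_trans)
  qed
  have "[NI S []] \<Rightarrow>\<^sub>G terminals (l @ expand B t 1 @ m @ expand B t 3 @ r)" for t
  proof -
    have 1: "inst [Y] y \<Rightarrow>\<^sub>G terminals (expand B t 1) @ terminals m @ terminals (expand B t 3)"
      using d[of t] derives_context[OF *(4)] by (meson rtranclp_trans)
    show ?thesis
      using *(2) derives_context[OF 1, of "terminals l" "terminals r"] by (simp add: rtranclp_trans)
  qed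
  then have "map fst (concat (map (expand B t) [0..<length B])) \<in> lang P S" for t
    using derives_lang[of "l @ expand B t 1 @ m @ expand B t 3 @ r"] by (simp only: nth up) (simp add: e)
  moreover have "concat (map (expand B 0) [0..<length B]) = w"
    unfolding nth up using e[of 0] e1(1,2) *(1) by simp
  moreover have "\<forall>b\<in>set B. \<forall>c\<in>set b. snd c < length B \<and> (marked (fst c) \<longrightarrow> marked (expand B 0 (snd c)))"
    using e[of 0] e1(1,2) unfolding nth(6) by (simp add: B_def)
  moreover have "\<exists>i<length B. \<exists>b1 c b2. B ! i = b1 @ c # b2 \<and> snd c = i \<and> marked (concat (map fst (b1 @ b2)))"
  proof (cases "marked a")
    case True
    then have "B ! 1 = [(a, 1)] @ ([], 1) # [] \<and> snd ([], 1) = 1 \<and> marked (concat (map fst ([(a, 1)] @ [])))"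
      by (simp add: B_def)
    moreover have "1 < length B" by (simp add: B_def)
    ultimately show ?thesis by (metis (no_types, lifting) snd_conv)
  next
    case False
    then have "B ! 3 = [] @ ([], 3) # [(b, 3)] \<and> snd ([], 3) = 3 \<and> marked (concat (map fst ([] @ [(b, 3)])))"
      using *(5) by (simp add: nth)
    moreover have "3 < length B" by (simp add: nth)
    ultimately show ?thesis by (metis (no_types, lifting) snd_conv)
  qed
  moreover have "B \<noteq> []" by (simp add: B_def)
  ultimately show ?thesis unfolding pumping_def by blast
qed

text \<open>Replaces \<open>s\<close> by its powers. The blocks are \<open>l\<close>, the yields of
  \<alpha>, of the single nodes of \<open>R'\<close> and of \<beta>, and \<open>r\<close>; the nodes
  of \<open>R\<close> are the factors inside the middle ones. Equal types let each node of
  \<open>R\<close> point to a node of \<open>R'\<close> with the same symbol and, if needed, a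
  mark.\<close>

lemma stack_pumping:
  assumes ctx: "[NI S []] \<Rightarrow>\<^sub>G terminals l @ inst [X] x @ terminals r"
    and lk: "link s True (X, x, Q1, k, Q2) (X, x', Q1', k', Q2')"
    and val: "valid_level (X, x, Q1, k, Q2)" "valid_level (X, x', Q1', k', Q2')"
    and k: "fst k = fst k'"
    and types: "(\<lambda>p. (fst p, marked (snd p))) ` set (Q1 @ k # Q2) =
      (\<lambda>p. (fst p, marked (snd p))) ` set (Q1' @ k' # Q2')"
    and w: "w = l @ yield (Q1 @ k # Q2) @ r"
  shows "\<exists>B. pumping (lang P S) w B"
proof -
  obtain \<alpha> \<rho>1 \<mu>1 \<mu>2 \<rho>2 \<beta> where a: "x' = s @ x" "Q1 = \<alpha> @ concat \<rho>1 @ \<mu>1" "Q2 = \<mu>2 @ concat \<rho>2 @ \<beta>"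
      "list_all2 (frontier s x) Q1' \<rho>1" "list_all2 (frontier s x) Q2' \<rho>2"
      "frontier s x k' (\<mu>1 @ k # \<mu>2)"
      "\<And>y. inst [X] y \<Rightarrow>\<^sub>G inst (map fst \<alpha>) y @ inst [X] (s @ y) @ inst (map fst \<beta>) y"
      "marked (yield (\<alpha> @ \<mu>1 @ \<mu>2 @ \<beta>))"
    using lk unfolding link.simps by blast
  define R where "R = Q1 @ k # Q2"
  define R' where "R' = Q1' @ k' # Q2'"
  define \<rho> where "\<rho> = \<rho>1 @ (\<mu>1 @ k # \<mu>2) # \<rho>2"
  define m where "m = length R'"
  have \<rho>: "list_all2 (frontier s x) R' \<rho>"
    using a by (auto simp: R'_def \<rho>_def intro!: list_all2_appendI)
  have m: "length \<rho> = m" using list_all2_lengthD[OF \<rho>] by (simp add: m_def)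
  have R: "R = \<alpha> @ concat \<rho> @ \<beta>" using a by (simp add: R_def \<rho>_def)
  have fr: "frontier s x (R' ! j) (\<rho> ! j)" if "j < m" for j
    using list_all2_nthD[OF \<rho>] that m_def by blast
  have "\<forall>p\<in>set R. \<exists>j<m. fst (R' ! j) = fst p \<and> (marked (snd p) \<longrightarrow> marked (snd (R' ! j)))"
  proof
    fix p assume "p \<in> set R"
    then have "(fst p, marked (snd p)) \<in> (\<lambda>p. (fst p, marked (snd p))) ` set R'"
      using types unfolding R_def R'_def by blast
    then obtain p' where "p' \<in> set R'" "fst p' = fst p" "marked (snd p') = marked (snd p)" by auto
    then show "\<exists>j<m. fst (R' ! j) = fst p \<and> (marked (snd p) \<longrightarrow> marked (snd (R' ! j)))"
      unfolding m_def by (metis in_set_conv_nth)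
  qed
  then obtain h0 where h0: "\<And>p. p \<in> set R \<Longrightarrow>
      h0 p < m \<and> fst (R' ! h0 p) = fst p \<and> (marked (snd p) \<longrightarrow> marked (snd (R' ! h0 p)))"
    by metis
  \<comment> \<open>\<open>k\<close> is sent to the block of \<open>k'\<close>, which contains it;
    this gives a factor pointing to its own block. The choice is admissible since the symbols agree
    and the yield of \<open>k\<close> is part of that of \<open>k'\<close>.\<close>
  define h where "h p = (if p = k then length Q1' else h0 p)" for p
  have h: "h p < m" "fst (R' ! h p) = fst p" "marked (snd p) \<Longrightarrow> marked (snd (R' ! h p))"
    if "p \<in> set R" for p
    using h0[OF that] k a(6) by (auto simp: h_def R'_def m_def frontier_def)
  define tg where "tg p = (snd p, 2 + h p)" for p
  \<comment> \<open>The empty factor before \<open>\<alpha>\<close> reproduces the side branches of the previous powers of \<open>s\<close>: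
    after \<open>t\<close> substitutions, the block reads off \<open>\<alpha>\<close> below the stacks \<open>x\<close>, \<open>s @ x\<close>, \<open>\<dots>\<close>.\<close>
  define B where "B = [[(l, 0)], ([], 1) # map tg \<alpha>] @ map (map tg) \<rho> @ [map tg \<beta> @ [([], m + 2)], [(r, m + 3)]]"
  have nth: "B ! 0 = [(l, 0)]" "B ! 1 = ([], 1) # map tg \<alpha>"
    "\<And>j. j < m \<Longrightarrow> B ! (2 + j) = map tg (\<rho> ! j)"
    "B ! (m + 2) = map tg \<beta> @ [([], m + 2)]" "B ! (m + 3) = [(r, m + 3)]" "length B = m + 4"
    by (auto simp: B_def m nth_append)
  have up: "[0..<m + 4] = 0 # 1 # map (\<lambda>j. 2 + j) [0..<m] @ [m + 2, m + 3]"
  proof -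
    have "map (\<lambda>j. 2 + j) [0..<m] = [2..<m + 2]" using map_add_upt[of 2 m] by (simp add: add.commute)
    moreover have "[0..<m + 4] = [0..<m + 2] @ [m + 2, m + 3]" by (simp add: numeral_eq_Suc)
    moreover have "[0..<m + 2] = 0 # 1 # [2..<m + 2]" by (simp add: upt_conv_Cons numeral_eq_Suc)
    ultimately show ?thesis by simp
  qed
  have e: "expand B t 0 = l" "expand B t (m + 3) = r" for t
    by (induction t) (simp_all add: nth)
  have tg: "concat (map (\<lambda>c. expand B t (snd c)) (map tg Q)) = concat (map (\<lambda>p. expand B t (2 + h p)) Q)" for t Q
    by (simp add: tg_def comp_def)
  have tg0: "concat (map fst (map tg Q)) = yield Q" for Q
    by (simp add: tg_def comp_def yield_def)
  have e0: "expand B 0 1 = yield \<alpha>" "expand B 0 (m + 2) = yield \<beta>"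
    using tg0[of \<alpha>] tg0[of \<beta>] unfolding expand.simps nth by simp_all
  have e0j: "expand B 0 (2 + j) = snd (R' ! j)" if "j < m" for j
    using fr[OF that] tg0[of "\<rho> ! j"] unfolding expand.simps nth(3)[OF that] frontier_def by simp
  have eS: "expand B (Suc t) 1 = expand B t 1 @ concat (map (\<lambda>p. expand B t (2 + h p)) \<alpha>)"
    "expand B (Suc t) (m + 2) = concat (map (\<lambda>p. expand B t (2 + h p)) \<beta>) @ expand B t (m + 2)" for t
    using tg[of t \<alpha>] tg[of t \<beta>] unfolding expand.simps nth by simp_all
  have eSj: "expand B (Suc t) (2 + j) = concat (map (\<lambda>p. expand B t (2 + h p)) (\<rho> ! j))" if "j < m" for t j
    using tg[of t "\<rho> ! j"] unfolding expand.simps nth(3)[OF that] .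
  define pw where "pw n = concat (replicate n s) @ x" for n
  have pw: "pw (Suc n) = s @ pw n" "pw 0 = x" for n by (auto simp: pw_def)
  have sub: "inst (map fst Q) y \<Rightarrow>\<^sub>G terminals (concat (map (\<lambda>p. expand B t (2 + h p)) Q))"
    if y: "\<And>j. j < m \<Longrightarrow> inst [fst (R' ! j)] y \<Rightarrow>\<^sub>G terminals (expand B t (2 + j))" "set Q \<subseteq> set R" for y t Q
  proof -
    have "\<forall>p\<in>set (map (\<lambda>p. (fst p, expand B t (2 + h p))) Q). inst [fst p] y \<Rightarrow>\<^sub>G terminals (snd p)"
    proof
      fix p' assume "p' \<in> set (map (\<lambda>p. (fst p, expand B t (2 + h p))) Q)"
      then obtain p where "p \<in> set R" "p' = (fst p, expand B t (2 + h p))" using y(2) by auto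
      then show "inst [fst p'] y \<Rightarrow>\<^sub>G terminals (snd p')" using y(1)[OF h(1)] h(2) by simp
    qed
    from derives_yield[OF this] show ?thesis by (simp add: comp_def yield_def)
  qed
  have \<rho>R: "set (\<rho> ! j) \<subseteq> set R" if "j < m" for j
    using nth_mem[of j \<rho>] that unfolding m R set_append set_concat by blast
  \<comment> \<open>In the induction step, consuming one \<open>s\<close> leaves nodes of
    \<open>R\<close> at stack \<open>pw (Suc t)\<close>; their images in \<open>R'\<close> are
    covered by the hypothesis.\<close>
  have c1: "inst [fst (R' ! j)] (pw (Suc t)) \<Rightarrow>\<^sub>G terminals (expand B t (2 + j))" if "j < m" for t j
    using that
  proof (induction t arbitrary: j)
    case 0
    have "inst [fst (R' ! j)] (s @ x) \<Rightarrow>\<^sub>G inst (map fst (\<rho> ! j)) x"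
      using fr[OF 0] by (simp add: frontier_def consumes_def)
    moreover have "inst (map fst (\<rho> ! j)) x \<Rightarrow>\<^sub>G terminals (snd (R' ! j))"
      using fr[OF 0] wf_at_derives by (simp add: frontier_def)
    ultimately show ?case unfolding pw e0j[OF 0] by (rule rtranclp_trans)
  next
    case (Suc t)
    have "inst [fst (R' ! j)] (s @ pw (Suc t)) \<Rightarrow>\<^sub>G inst (map fst (\<rho> ! j)) (pw (Suc t))"
      using fr[OF Suc.prems] by (simp add: frontier_def consumes_def)
    moreover have "inst (map fst (\<rho> ! j)) (pw (Suc t)) \<Rightarrow>\<^sub>G terminals (expand B (Suc t) (2 + j))"
      unfolding eSj[OF Suc.prems] using sub[OF Suc.IH \<rho>R[OF Suc.prems]] .
    ultimately show ?case unfolding pw(1)[of "Suc t"] by (rule rtranclp_trans)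
  qed
  \<comment> \<open>Pushing \<open>s\<close> once more leaves \<alpha> and \<beta> at stack
    \<open>pw (Suc t)\<close>; by \<open>sub\<close> and \<open>c1\<close> they derive exactly what
    one substitution adds to their two blocks.\<close>
  have c2: "inst [X] x \<Rightarrow>\<^sub>G terminals (expand B t 1) @ inst [X] (pw (Suc t)) @ terminals (expand B t (m + 2))" for t
  proof (induction t)
    case 0
    have "inst (map fst \<alpha>) x \<Rightarrow>\<^sub>G terminals (yield \<alpha>)" "inst (map fst \<beta>) x \<Rightarrow>\<^sub>G terminals (yield \<beta>)"
      using val(1) a by (auto intro!: wf_at_derives)
    then have "inst (map fst \<alpha>) x @ inst [X] (s @ x) @ inst (map fst \<beta>) x \<Rightarrow>\<^sub>G
        terminals (yield \<alpha>) @ inst [X] (s @ x) @ terminals (yield \<beta>)"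
      by (intro derives_append) auto
    then show ?case unfolding pw e0 using a(7)[of x] by (meson rtranclp_trans)
  next
    case (Suc t)
    let ?A = "concat (map (\<lambda>p. expand B t (2 + h p)) \<alpha>)" and ?B = "concat (map (\<lambda>p. expand B t (2 + h p)) \<beta>)"
    let ?y = "pw (Suc t)"
    have "inst (map fst \<alpha>) ?y \<Rightarrow>\<^sub>G terminals ?A" "inst (map fst \<beta>) ?y \<Rightarrow>\<^sub>G terminals ?B"
      using sub[OF c1, of \<alpha> t] sub[OF c1, of \<beta> t] by (auto simp: R)
    then have "inst (map fst \<alpha>) ?y @ inst [X] (s @ ?y) @ inst (map fst \<beta>) ?y \<Rightarrow>\<^sub>G
        terminals ?A @ inst [X] (s @ ?y) @ terminals ?B"
      by (intro derives_append) auto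
    then have "inst [X] ?y \<Rightarrow>\<^sub>G terminals ?A @ inst [X] (s @ ?y) @ terminals ?B"
      using a(7)[of ?y] by (meson rtranclp_trans)
    from derives_context[OF this, of "terminals (expand B t 1)" "terminals (expand B t (m + 2))"]
    have "terminals (expand B t 1) @ inst [X] ?y @ terminals (expand B t (m + 2)) \<Rightarrow>\<^sub>G
        terminals (expand B (Suc t) 1) @ inst [X] (pw (Suc (Suc t))) @ terminals (expand B (Suc t) (m + 2))"
      unfolding eS pw(1)[of "Suc t"] by simp
    then show ?case using Suc by (meson rtranclp_trans)
  qed
  \<comment> \<open>The inner level leads from \<open>X\<close> to the symbols of \<open>R'\<close>
    at every stack, hence also at the pumped one.\<close>
  have c3: "inst [X] (pw (Suc t)) \<Rightarrow>\<^sub>G terminals (concat (map (\<lambda>j. expand B t (2 + j)) [0..<m]))" for t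
  proof -
    define Q where "Q = map (\<lambda>j. (fst (R' ! j), expand B t (2 + j))) [0..<m]"
    have 1: "map fst Q = map fst R'"
      unfolding Q_def m_def using map_nth_upt[of fst R'] by (simp add: comp_def)
    have "inst (map fst Q) (pw (Suc t)) \<Rightarrow>\<^sub>G terminals (yield Q)"
      by (rule derives_yield) (auto simp: Q_def c1[simplified])
    moreover have "yield Q = concat (map (\<lambda>j. expand B t (2 + j)) [0..<m])"
      by (simp add: Q_def yield_def comp_def)
    moreover have "inst [X] (pw (Suc t)) \<Rightarrow>\<^sub>G inst (map fst R') (pw (Suc t))"
      using val(2) by (simp add: consumes_def R'_def)
    ultimately show ?thesis unfolding 1 by (metis rtranclp_trans)
  qed
  have ex: "concat (map (expand B t) [0..<length B]) =
      l @ expand B t 1 @ concat (map (\<lambda>j. expand B t (2 + j)) [0..<m]) @ expand B t (m + 2) @ r" for t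
    unfolding nth up by (simp add: e comp_def)
  have "[NI S []] \<Rightarrow>\<^sub>G terminals (concat (map (expand B t) [0..<length B]))" for t
  proof -
    have 1: "inst [X] x \<Rightarrow>\<^sub>G terminals (expand B t 1) @
        terminals (concat (map (\<lambda>j. expand B t (2 + j)) [0..<m])) @ terminals (expand B t (m + 2))"
      using c2[of t] derives_context[OF c3[of t]] by (meson rtranclp_trans)
    show ?thesis
      using ctx derives_context[OF 1, of "terminals l" "terminals r"] unfolding ex terminals_simps append_assoc
      by (meson rtranclp_trans)
  qed
  then have "map fst (concat (map (expand B t) [0..<length B])) \<in> lang P S" for t
    using derives_lang by blast
  moreover have "concat (map (expand B 0) [0..<length B]) = w"
  proof -
    have "map (\<lambda>j. expand B 0 (2 + j)) [0..<m] = map (\<lambda>j. snd (R' ! j)) [0..<m]"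
      by (intro map_cong refl e0j) simp
    then have "concat (map (\<lambda>j. expand B 0 (2 + j)) [0..<m]) = yield R'"
      using map_nth_upt[of snd R'] by (simp only: m_def yield_def)
    also have "\<dots> = yield (concat \<rho>)" using cuts_concat(2)[OF \<rho>] by simp
    finally show ?thesis unfolding ex e0 using w by (simp add: R R_def[symmetric])
  qed
  moreover have "\<forall>b\<in>set B. \<forall>c\<in>set b. snd c < length B \<and> (marked (fst c) \<longrightarrow> marked (expand B 0 (snd c)))"
  proof (intro ballI)
    fix b c assume bc: "b \<in> set B" "c \<in> set b"
    have "c \<in> {(l, 0), ([], 1), ([], m + 2), (r, m + 3)} \<union> tg ` set R"
    proof -
      consider "b \<in> {[(l, 0)], ([], 1) # map tg \<alpha>, map tg \<beta> @ [([], m + 2)], [(r, m + 3)]}"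
        | z where "z \<in> set \<rho>" "b = map tg z"
        using bc(1) by (auto simp: B_def)
      then show ?thesis
      proof cases
        case 1
        then show ?thesis using bc(2) by (auto simp: R)
      next
        case (2 z)
        then have "set z \<subseteq> set R" by (auto simp: R)
        then show ?thesis using 2 bc(2) by auto
      qed
    qed
    then consider "c = (l, 0)" | "c = ([], 1)" | "c = ([], m + 2)" | "c = (r, m + 3)"
      | p where "p \<in> set R" "c = tg p" by blast
    then show "snd c < length B \<and> (marked (fst c) \<longrightarrow> marked (expand B 0 (snd c)))"
    proof cases
      case (5 p)
      then show ?thesis unfolding nth using h[of p] e0j[of "h p"] by (simp add: tg_def)
    qed (use e[of 0] nth(6) in auto)
  qed
  moreover have "\<exists>i<length B. \<exists>b1 c b2. B ! i = b1 @ c # b2 \<and> snd c = i \<and> marked (concat (map fst (b1 @ b2)))"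
  proof -
    \<comment> \<open>Marks in \<alpha> or \<beta> lie beside the empty factor of their block, marks
      in \<mu>1 or \<mu>2 beside \<open>k\<close> in the block of \<open>k'\<close>.\<close>
    consider "marked (yield \<alpha>)" | "marked (yield \<beta>)" | "marked (yield (\<mu>1 @ \<mu>2))" using a(8) by auto
    then show ?thesis
    proof cases
      case 1
      then show ?thesis using nth(2,6) tg0[of \<alpha>]
        by (intro exI[of _ "1::nat"] conjI exI[of _ "[]"] exI[of _ "([], 1)"] exI[of _ "map tg \<alpha>"]) auto
    next
      case 2
      then show ?thesis using nth(4,6) tg0[of \<beta>]
        by (intro exI[of _ "m + 2"] conjI exI[of _ "map tg \<beta>"] exI[of _ "([], m + 2)"] exI[of _ "[]"]) auto
    next
      case 3
      have i: "length Q1' < m" by (simp add: m_def R'_def)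
      have "\<rho> ! length Q1' = \<mu>1 @ k # \<mu>2"
        using list_all2_lengthD[OF a(4)] by (simp add: \<rho>_def nth_append)
      then have "B ! (2 + length Q1') = map tg \<mu>1 @ tg k # map tg \<mu>2" using nth(3)[OF i] by simp
      moreover have "snd (tg k) = 2 + length Q1'" by (simp add: tg_def h_def)
      moreover have "marked (concat (map fst (map tg \<mu>1 @ map tg \<mu>2)))"
        using 3 tg0[of "\<mu>1 @ \<mu>2"] by simp
      moreover have "2 + length Q1' < length B" using i nth(6) by simp
      ultimately show ?thesis by blast
    qed
  qed
  moreover have "B \<noteq> []" by (simp add: B_def)
  ultimately show ?thesis unfolding pumping_def by blast
qed

text \<open>Deriving only \<alpha> and \<beta> to terminals exposes the later level in its context.
  What lies between them has the yield of that level because cuts preserve yields.\<close>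

lemma link_context:
  assumes "link s g (X, x, Q1, k, Q2) (X', x', Q1', k', Q2')" "valid_level (X, x, Q1, k, Q2)"
  shows "\<exists>a b. inst [X] x \<Rightarrow>\<^sub>G terminals a @ inst [X'] x' @ terminals b \<and>
    yield (Q1 @ k # Q2) = a @ yield (Q1' @ k' # Q2') @ b"
proof -
  obtain \<alpha> \<rho>1 \<mu>1 \<mu>2 \<rho>2 \<beta> where a: "x' = s @ x" "Q1 = \<alpha> @ concat \<rho>1 @ \<mu>1" "Q2 = \<mu>2 @ concat \<rho>2 @ \<beta>"
      "list_all2 (frontier s x) Q1' \<rho>1" "list_all2 (frontier s x) Q2' \<rho>2"
      "frontier s x k' (\<mu>1 @ k # \<mu>2)"
      "\<And>y. inst [X] y \<Rightarrow>\<^sub>G inst (map fst \<alpha>) y @ inst [X'] (s @ y) @ inst (map fst \<beta>) y"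
    using assms(1) unfolding link.simps by blast
  have "inst (map fst \<alpha>) x \<Rightarrow>\<^sub>G terminals (yield \<alpha>)" "inst (map fst \<beta>) x \<Rightarrow>\<^sub>G terminals (yield \<beta>)"
    using assms(2) a by (auto intro!: wf_at_derives)
  then have "inst (map fst \<alpha>) x @ inst [X'] x' @ inst (map fst \<beta>) x \<Rightarrow>\<^sub>G
      terminals (yield \<alpha>) @ inst [X'] x' @ terminals (yield \<beta>)"
    by (intro derives_append) auto
  then have "inst [X] x \<Rightarrow>\<^sub>G terminals (yield \<alpha>) @ inst [X'] x' @ terminals (yield \<beta>)"
    using a(7)[of x] unfolding a(1) by (meson rtranclp_trans)
  moreover have "yield (Q1 @ k # Q2) = yield \<alpha> @ yield (Q1' @ k' # Q2') @ yield \<beta>"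
    using a(6) cuts_concat(2)[OF a(4)] cuts_concat(2)[OF a(5)] by (simp add: a(2,3) frontier_def)
  ultimately show ?thesis by blast
qed

section \<open>Pigeonhole over the types of levels\<close>

text \<open>Without stack and words only finitely many types remain. The last component records
  which targets are available to the factors.\<close>

fun level_type :: "('n, 't, 'f) level \<Rightarrow> ('n + 't) \<times> ('n + 't) \<times> (('n + 't) \<times> bool) set" where
  "level_type (X, x, Q, k, Q') = (X, fst k, (\<lambda>p. (fst p, marked (snd p))) ` set (Q @ k # Q'))"

definition level_types :: "(('n + 't) \<times> ('n + 't) \<times> (('n + 't) \<times> bool) set) set" where
  "level_types = V \<times> V \<times> Pow (V \<times> UNIV)"

lemma finite_level_types: "finite level_types"
  by (simp add: level_types_def finite_V)

lemma level_type_in: "valid_level lv \<Longrightarrow> level_type lv \<in> level_types"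
  by (cases lv) (auto simp: level_types_def wf_at_def)

lemma pumping_exists:
  "\<exists>N. \<forall>w. map fst w \<in> lang P S \<and> N \<le> marks w \<longrightarrow> (\<exists>B. pumping (lang P S) w B)"
proof -
  obtain N where N: "\<And>w. map fst w \<in> lang P S \<Longrightarrow> N \<le> marks w \<Longrightarrow> cf_pumpable [] (Inl S, w) \<or>
    (\<exists>L p R ls q. frontier [] [] (Inl S, w) (L @ p # R) \<and> length ls = Suc (card level_types) \<and> chain ls [] p q)"
    using long_chain_exists[of "card level_types"] by blast
  have "\<exists>B. pumping (lang P S) w B" if w: "map fst w \<in> lang P S" "N \<le> marks w" for w
  proof (cases "cf_pumpable [] (Inl S, w)")
    case True
    then show ?thesis by (rule cf_pumpable_pumping)
  next
    case False
    then obtain L p R ls q where f: "frontier [] [] (Inl S, w) (L @ p # R)"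
      and len: "length ls = Suc (card level_types)" and c: "chain ls [] p q"
      using N[OF w] by blast
    have "(\<lambda>i. level_type (ls ! i)) ` {..<length ls} \<subseteq> level_types"
    proof (intro image_subsetI)
      fix i assume "i \<in> {..<length ls}"
      then have "valid_level (ls ! i)" using c unfolding chain_def by simp
      then show "level_type (ls ! i) \<in> level_types" by (rule level_type_in)
    qed
    then have "card ((\<lambda>i. level_type (ls ! i)) ` {..<length ls}) \<le> card level_types"
      using card_mono finite_level_types by blast
    then have "\<not> inj_on (\<lambda>i. level_type (ls ! i)) {..<length ls}"
      using len by (intro pigeonhole) simp
    then obtain i' j' where "i' < length ls" "j' < length ls" "i' \<noteq> j'"
      "level_type (ls ! i') = level_type (ls ! j')" unfolding inj_on_def by auto
    then obtain i j where ij: "i < j" "j < length ls" "level_type (ls ! i) = level_type (ls ! j)"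
      by (metis linorder_neqE_nat)
    obtain s where s: "link s True (ls ! i) (ls ! j)"
      using c ij sorted_wrt_nth_less unfolding chain_def by blast
    have val: "valid_level (ls ! i)" "valid_level (ls ! j)" "valid_level (ls ! 0)"
      using c ij by (auto simp: chain_def)
    obtain X x Q1 k Q2 where li: "ls ! i = (X, x, Q1, k, Q2)" by (cases "ls ! i")
    obtain X' x' Q1' k' Q2' where lj: "ls ! j = (X', x', Q1', k', Q2')" by (cases "ls ! j")
    obtain H1 H2 where hd: "ls ! 0 = (fst p, [], H1, q, H2)" "yield (H1 @ q # H2) = snd p"
      using c by (auto simp: chain_def hd_conv_nth)
    \<comment> \<open>Level 0 starts at \<open>p\<close>, so its link to level \<open>i\<close>
      gives the context of \<open>X\<close> below \<open>p\<close>.\<close>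
    have "\<exists>a b. inst [fst p] [] \<Rightarrow>\<^sub>G terminals a @ inst [X] x @ terminals b \<and>
        snd p = a @ yield (Q1 @ k # Q2) @ b"
    proof (cases "i = 0")
      case True
      then show ?thesis using hd li by (intro exI[of _ "[]"]) auto
    next
      case False
      then obtain s0 where "link s0 True (ls ! 0) (ls ! i)"
        using c ij sorted_wrt_nth_less[of _ ls 0 i] unfolding chain_def by auto
      then show ?thesis using link_context[of s0 True "fst p" "[]" H1 q H2 X x Q1 k Q2] val(3) hd li by simp
    qed
    then obtain a b where ab: "inst [fst p] [] \<Rightarrow>\<^sub>G terminals a @ inst [X] x @ terminals b"
      "snd p = a @ yield (Q1 @ k # Q2) @ b" by blast
    have "[NI S []] \<Rightarrow>\<^sub>G terminals (yield L) @ inst [fst p] [] @ terminals (yield R)"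
      using frontier_derives[OF f] by simp
    then have ctx: "[NI S []] \<Rightarrow>\<^sub>G terminals (yield L @ a) @ inst [X] x @ terminals (b @ yield R)"
      using derives_context[OF ab(1), of "terminals (yield L)" "terminals (yield R)"]
      by (simp add: rtranclp_trans)
    have w': "w = (yield L @ a) @ yield (Q1 @ k # Q2) @ (b @ yield R)"
      using f ab(2) by (simp add: frontier_def)
    have t: "X' = X" "fst k = fst k'" "(\<lambda>p. (fst p, marked (snd p))) ` set (Q1 @ k # Q2) =
        (\<lambda>p. (fst p, marked (snd p))) ` set (Q1' @ k' # Q2')"
      using ij(3) unfolding li lj level_type.simps by blast+
    show ?thesis
      by (rule stack_pumping[OF ctx s[unfolded li lj t(1)] val(1)[unfolded li]
            val(2)[unfolded lj t(1)] t(2,3) w'])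
  qed
  then show ?thesis by blast
qed

end

text \<open>Marking the letters at the positions in \<open>M\<close> gives \<open>card M\<close>
  marks, so the bound for marked words serves as \<open>l\<close>.\<close>

theorem theorem1:
  fixes L :: "'t list set"
  assumes "indexed_language L"
  shows "\<exists>l::nat. \<forall>w \<in> L. \<forall>M. M \<subseteq> {..<length w} \<and> card M \<ge> l \<longrightarrow>
    (\<exists>(vs :: 't list list list) (\<phi> :: nat \<Rightarrow> nat \<Rightarrow> nat).
       length vs \<ge> 1 \<and> word_of vs = w \<and>
       (\<forall>i < length vs. \<forall>j < length (vs ! i). \<phi> i j < length vs) \<and>
       (\<forall>t. word_of (pump vs \<phi> t) \<in> L) \<and>
       (\<forall>i < length vs. \<forall>j < length (vs ! i).
          v_pos vs i j \<inter> M \<noteq> {} \<longrightarrow> u_pos vs (\<phi> i j) \<inter> M \<noteq> {}) \<and>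
       (\<exists>i < length vs. \<exists>j < length (vs ! i). \<phi> i j = i \<and>
          (u_pos vs i - v_pos vs i j) \<inter> M \<noteq> {}))"
proof -
  obtain P :: "(nat, 't, nat) production set" and S where P: "finite P" and L: "L = lang P S"
    using assms unfolding indexed_language_def by blast
  interpret indexed_grammar P S by standard (rule P)
  obtain N where N: "\<And>w. map fst w \<in> L \<Longrightarrow> N \<le> marks w \<Longrightarrow> \<exists>B. pumping L w B"
    using pumping_exists unfolding L by blast
  have marks: "marks (map (\<lambda>k. (w ! k, k \<in> M)) [0..<length w]) = card M"
    if "M \<subseteq> {..<length w}" for w :: "'t list" and M
  proof -
    have "marks (map (\<lambda>k. (w ! k, k \<in> M)) [0..<length w]) = length (filter (\<lambda>k. k \<in> M) [0..<length w])"
      by (simp add: marks_def filter_map comp_def)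
    also have "\<dots> = card (set (filter (\<lambda>k. k \<in> M) [0..<length w]))"
      by (rule distinct_card[symmetric]) simp
    also have "set (filter (\<lambda>k. k \<in> M) [0..<length w]) = M" using that by auto
    finally show ?thesis .
  qed
  have "\<exists>B. pumping L (map (\<lambda>k. (w ! k, k \<in> M)) [0..<length w]) B"
    if "w \<in> L" "M \<subseteq> {..<length w}" "card M \<ge> N" for w M
    using that marks[OF that(2)] by (intro N) (simp_all add: comp_def map_nth)
  then obtain B where B: "\<And>w M. w \<in> L \<Longrightarrow> M \<subseteq> {..<length w} \<Longrightarrow> card M \<ge> N \<Longrightarrow>
      pumping L (map (\<lambda>k. (w ! k, k \<in> M)) [0..<length w]) (B w M)"
    by metis
  show ?thesis
    by (intro exI[of _ N] ballI allI impI, elim conjE, rule pumping_factorization, rule B)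
qed

end
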